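(* Let $f\in\mathcal{S}$ be given by $f(z)=z+\sum_{n=2}^{\infty}a_nz^n$ for $|z|<1$, and suppose that $a_2=0$. Then (i) $|a_3|\le 1$; (ii) $|a_4|\le \frac23$; (iii) $|a_5|\le \frac{503}{300}=1.67666\ldots$; (iv) $|H_2(2)|\le 1$; (v) $|H_3(1)|\le \frac{21}{20}=1.05$.
   Context: Let $\mathbb{D}=\{z\in\mathbb{C}:|z|<1\}$. $\mathcal{S}$ denotes the class of functions $f$ that are analytic and univalent (injective) in $\mathbb{D}$, with power series expansion $f(z)=z+a_2z^2+a_3z^3+\cdots$ (so $f(0)=0$, $f'(0)=1$). For such $f$ the second and third Hankel determinants are $$H_2(2)=a_2a_4-a_3^2,\qquad H_3(1)=a_3(a_2a_4-a_3^2)-a_4(a_4-a_2a_3)+a_5(a_3-a_2^2).$$ *)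

theory Defs
  imports "HOL-Complex_Analysis.Complex_Analysis"
begin

definition class_S :: "(complex \<Rightarrow> complex) set" where
  "class_S = {f. f analytic_on ball 0 1 \<and> inj_on f (ball 0 1) \<and> f 0 = 0 \<and> deriv f 0 = 1}"

definition H2_2 :: "(nat \<Rightarrow> complex) \<Rightarrow> complex" where
  "H2_2 a = a 2 * a 4 - (a 3)\<^sup>2"

text \<open>The third Hankel determinant of the normalised coefficient sequence: the first
  coefficient is 1 and is already substituted, so the value of \<open>a\<close> at 1 does not enter.\<close>

definition H3_1 :: "(nat \<Rightarrow> complex) \<Rightarrow> complex" where
  "H3_1 a = a 3 * (a 2 * a 4 - (a 3)\<^sup>2) - a 4 * (a 4 - a 2 * a 3) + a 5 * (a 3 - (a 2)\<^sup>2)"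

end

theory Submission
  imports Defs
begin

text \<open>
  All five bounds come from the Grunsky inequality, applied with the indices 1 and 3 to \<open>f\<close> and to
  its square root transform \<open>q z = sqrt (f (z\<^sup>2))\<close>. If \<open>a 2 = 0\<close>, the Grunsky coefficients of \<open>f\<close>
  are \<open>a 3\<close> for the index pair (1,1) and \<open>a 5 - (a 3)\<^sup>2\<close> for (1,3), and the one of \<open>q\<close> for (3,3) is
  \<open>a 4 / 2\<close>. The inequality bounds them by 1, \<open>1 / sqrt 3\<close> and \<open>1 / 3\<close>
  (lemmas \<open>univalent_coefficient_bounds\<close> and \<open>odd_square_root_transform\<close>). The bounds on \<open>a 5\<close> and on the
  Hankel determinants then follow from the triangle inequality, since
  \<open>H3_1 a = a 3 * (a 5 - (a 3)\<^sup>2) - (a 4)\<^sup>2\<close> when \<open>a 2 = 0\<close>.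

  The Grunsky inequality (\<open>grunsky_inequality\<close>) expresses that a charge distribution of total mass 0 has
  nonnegative logarithmic energy. Put a trigonometric polynomial as charge density on the circle
  \<open>|z| = r\<close> and transport it by \<open>f\<close>. Because \<open>f\<close> is injective, \<open>f z - f \<zeta>\<close> equals
  \<open>(z - \<zeta>) exp (l z)\<close> with a holomorphic \<open>l\<close>, so the energy of the image is the energy of the
  charge on the circle, which is explicit, minus a quadratic form in the Taylor coefficients of this
  logarithm (\<open>circle_self_energy\<close>, \<open>image_energy\<close>).

  Positivity of the energy is obtained without potential theory. On the Riemann sphere the chordal
  distance satisfies \<open>d(u,v)\<^sup>2 = 1 - K(u,v)\<close> up to scaling, where \<open>K\<close> is a positive definite kernel of
  finite rank with values between 0 and 1; hence \<open>- ln (1 - q K)\<close> with \<open>0 \<le> q < 1\<close> is a power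
  series in \<open>K\<close> with nonnegative coefficients and is positive definite as well (\<open>log_sph_ker_positive\<close>).
  For \<open>q < 1\<close> everything is continuous. In the limit \<open>q\<close> to 1 the logarithmic singularity on the
  diagonal is compensated by that of the correspondingly regularised kernel of the circle, and the
  difference converges boundedly (\<open>regularised_energy_limit\<close>).
\<close>

section \<open>Integrals over the torus\<close>

definition torus_integral :: "(real \<Rightarrow> real \<Rightarrow> real) \<Rightarrow> real" where
  "torus_integral k = integral {0..2*pi} (\<lambda>s. integral {0..2*pi} (k s))"

lemma continuous_kernel_slice:
  assumes "continuous_on UNIV (\<lambda>p. k (fst p) (snd p))"
  shows "continuous_on A (k (s::real) :: real \<Rightarrow> real)"
proof -
  have "continuous_on A ((\<lambda>p. k (fst p) (snd p)) \<circ> (\<lambda>t. (s, t)))"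
    by (intro continuous_on_compose continuous_intros continuous_on_subset[OF assms]) auto
  then show ?thesis
    by (simp add: o_def)
qed

lemma continuous_inner_integral:
  fixes k :: "real \<Rightarrow> real \<Rightarrow> real"
  assumes "continuous_on UNIV (\<lambda>p. k (fst p) (snd p))"
  shows "continuous_on A (\<lambda>s. integral {a..b} (k s))"
proof -
  have "continuous_on A (\<lambda>s. integral (cbox a b) (k s))"
    by (rule integral_continuous_on_param)
       (use continuous_on_subset[OF assms, of "A \<times> cbox a b"] in \<open>simp add: case_prod_unfold\<close>)
  then show ?thesis
    by (simp add: cbox_interval)
qed

lemmas inner_integrable [intro] =
  integrable_continuous_interval[OF continuous_kernel_slice]
  integrable_continuous_interval[OF continuous_inner_integral]

lemma torus_integral_add:
  assumes "continuous_on UNIV (\<lambda>p. k (fst p) (snd p))" "continuous_on UNIV (\<lambda>p. l (fst p) (snd p))"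
  shows "torus_integral (\<lambda>s t. k s t + l s t) = torus_integral k + torus_integral l"
  unfolding torus_integral_def
  using assms by (simp add: integral_add inner_integrable)

lemma torus_integral_cmult:
  "torus_integral (\<lambda>s t. c * k s t) = c * torus_integral k"
  unfolding torus_integral_def by simp

lemma torus_integral_sum:
  assumes "finite A" "\<And>i. i \<in> A \<Longrightarrow> continuous_on UNIV (\<lambda>p. k i (fst p) (snd p))"
  shows "torus_integral (\<lambda>s t. \<Sum>i\<in>A. k i s t) = (\<Sum>i\<in>A. torus_integral (k i))"
  using assms
proof (induction rule: finite_induct)
  case empty
  then show ?case by (simp add: torus_integral_def)
next
  case (insert i A)
  have "continuous_on UNIV (\<lambda>p. \<Sum>i\<in>A. k i (fst p) (snd p))"
    by (intro continuous_on_sum insert.prems) auto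
  then show ?case
    using insert by (simp add: torus_integral_add[of "k i" "\<lambda>s t. \<Sum>i\<in>A. k i s t"])
qed

lemma bounded_convergence_off_finite:
  fixes f :: "nat \<Rightarrow> real \<Rightarrow> real"
  assumes f: "\<And>k. f k integrable_on {a..b}"
    and bound: "\<And>k x. x \<in> {a..b} \<Longrightarrow> \<bar>f k x\<bar> \<le> B"
    and fin: "finite N"
    and conv: "\<And>x. x \<in> {a..b} - N \<Longrightarrow> (\<lambda>k. f k x) \<longlonglongrightarrow> g x"
  shows "(\<lambda>k. integral {a..b} (f k)) \<longlonglongrightarrow> integral {a..b} g"
proof -
  define f' where "f' = (\<lambda>k x. if x \<in> N then 0 else f k x)"
  define g' where "g' = (\<lambda>x. if x \<in> N then 0 else g x)"
  have neg: "negligible N"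
    using fin by (rule negligible_finite)
  have int: "f' k integrable_on {a..b}" for k
    by (rule integrable_spike[OF f neg]) (auto simp: f'_def)
  have "(\<lambda>k. integral {a..b} (f' k)) \<longlonglongrightarrow> integral {a..b} g'"
  proof (rule dominated_convergence(2)[where h = "\<lambda>_. \<bar>B\<bar>"])
    show "norm (f' k x) \<le> \<bar>B\<bar>" if "x \<in> {a..b}" for k x
      using bound[OF that, of k] by (auto simp: f'_def)
    show "(\<lambda>k. f' k x) \<longlonglongrightarrow> g' x" if "x \<in> {a..b}" for x
      using conv[of x] that by (auto simp: f'_def g'_def)
  qed (use int in auto)
  moreover have "integral {a..b} (f' k) = integral {a..b} (f k)" for k
    by (rule integral_spike[OF neg]) (auto simp: f'_def)
  moreover have "integral {a..b} g' = integral {a..b} g"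
    by (rule integral_spike[OF neg]) (auto simp: g'_def)
  ultimately show ?thesis by simp
qed

text \<open>The exceptional set is finite on every slice: in the application it is the diagonal of the torus,
where the limit kernel is singular. Since the integral is iterated, this is bounded convergence in
one variable, applied twice.\<close>

lemma torus_bounded_convergence:
  fixes k :: "nat \<Rightarrow> real \<Rightarrow> real \<Rightarrow> real"
  assumes cont: "\<And>n. continuous_on UNIV (\<lambda>p. k n (fst p) (snd p))"
    and bound: "\<And>n s t. \<bar>k n s t\<bar> \<le> B"
    and fin: "\<And>s. finite (N s)"
    and conv: "\<And>s t. s \<in> {0..2*pi} \<Longrightarrow> t \<in> {0..2*pi} - N s \<Longrightarrow> (\<lambda>n. k n s t) \<longlonglongrightarrow> l s t"
  shows "(\<lambda>n. torus_integral (k n)) \<longlonglongrightarrow> torus_integral l"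
  unfolding torus_integral_def
proof (rule bounded_convergence_off_finite[where N = "{}" and B = "2*pi*B"])
  show "\<bar>integral {0..2*pi} (k n s)\<bar> \<le> 2*pi*B" for n s
  proof -
    have "norm (integral {0..2*pi} (k n s)) \<le> B * (2*pi - 0)"
      by (rule integral_bound) (use bound cont in \<open>auto intro!: continuous_kernel_slice\<close>)
    then show ?thesis by (simp add: mult_ac)
  qed
  show "(\<lambda>n. integral {0..2*pi} (k n s)) \<longlonglongrightarrow> integral {0..2*pi} (l s)" if "s \<in> {0..2*pi} - {}" for s
    by (rule bounded_convergence_off_finite[where N = "N s" and B = B])
       (use that bound cont fin conv in auto)
qed (use cont in auto)

section \<open>Positivity of the logarithmic energy\<close>

text \<open>This kernel is the squared modulus of the normalised inner product of \<open>(1, u)\<close> and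
\<open>(1, v)\<close>. Its complement to 1 is the squared chordal distance of \<open>u\<close> and \<open>v\<close> on
the Riemann sphere, so \<open>- ln (1 - sph_ker u v)\<close> is a logarithmic potential
\<open>- 2 ln |u - v|\<close> up to a function of \<open>u\<close> plus a function of \<open>v\<close>. Such summands
drop out against a density of total mass 0.\<close>

definition sph_ker :: "complex \<Rightarrow> complex \<Rightarrow> real" where
  "sph_ker u v = (cmod (1 + u * cnj v))\<^sup>2 / ((1 + (cmod u)\<^sup>2) * (1 + (cmod v)\<^sup>2))"

lemma one_minus_sph_ker:
  "1 - sph_ker u v = (cmod (u - v))\<^sup>2 / ((1 + (cmod u)\<^sup>2) * (1 + (cmod v)\<^sup>2))"
proof -
  have *: "(1 + (cmod u)\<^sup>2) * (1 + (cmod v)\<^sup>2) - (cmod (1 + u * cnj v))\<^sup>2 = (cmod (u - v))\<^sup>2"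
    unfolding cmod_power2 by (simp add: power2_eq_square algebra_simps)
  have "1 + (cmod u)\<^sup>2 > 0" "1 + (cmod v)\<^sup>2 > 0"
    by (simp_all add: add_pos_nonneg)
  then show ?thesis
    unfolding sph_ker_def *[symmetric] by (simp add: diff_divide_distrib)
qed

lemma sph_ker_nonneg: "0 \<le> sph_ker u v"
  by (simp add: sph_ker_def)

lemma sph_ker_le_1: "sph_ker u v \<le> 1"
proof -
  have "0 \<le> 1 - sph_ker u v"
    unfolding one_minus_sph_ker by simp
  then show ?thesis by simp
qed

text \<open>Stereographic projection: up to the common factor \<open>1 / sqrt 2\<close>, an orthogonal change of
coordinates turns these four real functions into the constant 1 and the coordinates of the point of
the unit sphere that represents \<open>u\<close>.\<close>

definition sph_feature :: "nat \<Rightarrow> complex \<Rightarrow> real" where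
  "sph_feature i u = (if i = 0 then 1 else if i = 1 then sqrt 2 * Re u
      else if i = 2 then sqrt 2 * Im u else (cmod u)\<^sup>2) / (1 + (cmod u)\<^sup>2)"

lemma sph_ker_features:
  "sph_ker u v = (\<Sum>i<4. sph_feature i u * sph_feature i v)"
proof -
  let ?e = sph_feature
  have root2: "sqrt 2 * x * (sqrt 2 * y) = 2 * x * y" for x y :: real
    by simp
  have "(\<Sum>i<4. ?e i u * ?e i v) = ?e 0 u * ?e 0 v + ?e 1 u * ?e 1 v + ?e 2 u * ?e 2 v + ?e 3 u * ?e 3 v"
    by (simp add: eval_nat_numeral)
  also have "\<dots> = (1 + 2 * Re u * Re v + 2 * Im u * Im v + (cmod u)\<^sup>2 * (cmod v)\<^sup>2)
      / ((1 + (cmod u)\<^sup>2) * (1 + (cmod v)\<^sup>2))"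
    by (simp add: sph_feature_def add_divide_distrib root2)
  also have "1 + 2 * Re u * Re v + 2 * Im u * Im v + (cmod u)\<^sup>2 * (cmod v)\<^sup>2
      = (cmod (1 + u * cnj v))\<^sup>2"
    unfolding cmod_power2 by (simp add: power2_eq_square algebra_simps)
  finally show ?thesis
    by (simp add: sph_ker_def)
qed

lemma continuous_on_comp_fst_snd:
  assumes "continuous_on UNIV (w :: real \<Rightarrow> 'a::topological_space)"
  shows "continuous_on UNIV (\<lambda>p::real\<times>real. w (fst p))" "continuous_on UNIV (\<lambda>p::real\<times>real. w (snd p))"
  by (rule continuous_on_compose2[OF assms]; auto intro!: continuous_intros)+

lemma one_plus_cmod_sq_neq_0 [simp]: "1 + (cmod u)\<^sup>2 \<noteq> 0"
  by (simp add: add_pos_nonneg pos_add_strict order.strict_implies_not_eq[symmetric])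

lemma continuous_on_sph_ker:
  assumes "continuous_on A f" "continuous_on A g"
  shows "continuous_on A (\<lambda>x. sph_ker (f x) (g x))"
  unfolding sph_ker_def by (intro continuous_intros assms) simp_all

text \<open>The Schur product argument. Multiplying a kernel by \<open>sph_ker\<close> splits it into four kernels of the
old shape, in which the density is multiplied by one of the real features of \<open>sph_ker\<close>; hence the
induction runs over all densities at once.\<close>

lemma sph_ker_power_positive:
  assumes w: "continuous_on UNIV w" and c: "continuous_on UNIV c"
  shows "0 \<le> torus_integral (\<lambda>s t. c s * c t * sph_ker (w s) (w t) ^ n)"
  using c
proof (induction n arbitrary: c)
  case 0
  have "torus_integral (\<lambda>s t. c s * c t) = (integral {0..2*pi} c)\<^sup>2"
    by (simp add: torus_integral_def power2_eq_square)
  then show ?case by simp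
next
  case (Suc n)
  let ?e = sph_feature
  have e_cont: "continuous_on UNIV (\<lambda>s. ?e i (w s))" for i
    unfolding sph_feature_def by (cases "i = 0"; cases "i = 1"; cases "i = 2") (auto intro!: continuous_intros w)
  let ?k = "\<lambda>i s t. (c s * ?e i (w s)) * (c t * ?e i (w t)) * sph_ker (w s) (w t) ^ n"
  have "(\<lambda>s t. c s * c t * sph_ker (w s) (w t) ^ Suc n) = (\<lambda>s t. \<Sum>i<4. ?k i s t)"
    unfolding power_Suc by (subst (1) sph_ker_features) (simp add: sum_distrib_left sum_distrib_right mult_ac)
  then have "torus_integral (\<lambda>s t. c s * c t * sph_ker (w s) (w t) ^ Suc n) = (\<Sum>i<4. torus_integral (?k i))"
    by (simp only:) (intro torus_integral_sum continuous_intros continuous_on_sph_ker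
        continuous_on_comp_fst_snd w Suc.prems continuous_on_comp_fst_snd[OF e_cont]; simp)
  also have "\<dots> \<ge> 0"
    by (intro sum_nonneg Suc.IH continuous_intros Suc.prems e_cont)
  finally show ?case .
qed

text \<open>The logarithm is a power series in \<open>sph_ker\<close> with nonnegative coefficients, so positivity passes
from the powers to the sum. The factor \<open>q < 1\<close> keeps the kernel bounded on the diagonal.\<close>

lemma log_sph_ker_positive:
  assumes w: "continuous_on UNIV w" and c: "continuous_on UNIV c" and cb: "\<And>t. \<bar>c t\<bar> \<le> C"
    and q: "0 \<le> q" "q < 1"
  shows "0 \<le> torus_integral (\<lambda>s t. c s * c t * - ln (1 - q * sph_ker (w s) (w t)))"
proof -
  have partial: "(\<lambda>n. \<Sum>m<n. x ^ m / m) \<longlonglongrightarrow> - ln (1 - x)" "(\<Sum>m<n. x ^ m / m) \<le> - ln (1 - x)"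
      "0 \<le> (\<Sum>m<n. x ^ m / m)"
    if "0 \<le> x" "x < 1" for x :: real and n
  proof -
    have "(\<lambda>n. - ((- (- x)) ^ n) / of_nat n) sums ln (1 + (- x))"
      by (rule ln_series') (use that in auto)
    from sums_minus[OF this] have *: "(\<lambda>n. x ^ n / n) sums (- ln (1 - x))"
      by simp
    then show "(\<lambda>n. \<Sum>m<n. x ^ m / m) \<longlonglongrightarrow> - ln (1 - x)"
      by (simp add: sums_def)
    show "(\<Sum>m<n. x ^ m / m) \<le> - ln (1 - x)"
      using sum_le_suminf[OF sums_summable[OF *], of "{..<n}"] that sums_unique[OF *] by simp
    show "0 \<le> (\<Sum>m<n. x ^ m / m)"
      using that by (intro sum_nonneg) simp
  qed
  have qx: "0 \<le> q * sph_ker u v" "q * sph_ker u v \<le> q" "q * sph_ker u v < 1" for u v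
    using q sph_ker_nonneg[of u v] sph_ker_le_1[of u v] mult_left_le[of "sph_ker u v" q] by auto
  let ?k = "\<lambda>n s t. c s * c t * (\<Sum>m<n. (q * sph_ker (w s) (w t)) ^ m / m)"
  have C: "0 \<le> C" using cb[of 0] by linarith
  have "(\<lambda>n. torus_integral (?k n)) \<longlonglongrightarrow> torus_integral (\<lambda>s t. c s * c t * - ln (1 - q * sph_ker (w s) (w t)))"
  proof (rule torus_bounded_convergence[where N = "\<lambda>_. {}" and B = "C * C * - ln (1 - q)"])
    show "\<bar>?k n s t\<bar> \<le> C * C * - ln (1 - q)" for n s t
    proof -
      have "- ln (1 - q * sph_ker (w s) (w t)) \<le> - ln (1 - q)"
        using qx[of "w s" "w t"] q by simp
      then have "\<bar>\<Sum>m<n. (q * sph_ker (w s) (w t)) ^ m / m\<bar> \<le> - ln (1 - q)"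
        using partial(2,3)[OF qx(1)[of "w s" "w t"] qx(3)[of "w s" "w t"], of n] by linarith
      then show ?thesis
        unfolding abs_mult using cb C by (intro mult_mono) auto
    qed
    show "continuous_on UNIV (\<lambda>p. ?k n (fst p) (snd p))" for n
      unfolding divide_inverse
      by (intro continuous_intros continuous_on_sph_ker continuous_on_comp_fst_snd w c)
    show "(\<lambda>n. ?k n s t) \<longlonglongrightarrow> c s * c t * - ln (1 - q * sph_ker (w s) (w t))" for s t
      by (intro tendsto_intros partial qx)
  qed auto
  moreover have "0 \<le> torus_integral (?k n)" for n
  proof -
    have "?k n = (\<lambda>s t. \<Sum>m<n. (q ^ m / m) * (c s * c t * sph_ker (w s) (w t) ^ m))"
      by (simp add: fun_eq_iff sum_distrib_left power_mult_distrib mult_ac)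
    then have "torus_integral (?k n) = (\<Sum>m<n. torus_integral (\<lambda>s t. (q ^ m / m) * (c s * c t * sph_ker (w s) (w t) ^ m)))"
      by (simp only:) (intro torus_integral_sum continuous_intros continuous_on_sph_ker
        continuous_on_comp_fst_snd w c; simp)
    also have "\<dots> \<ge> 0"
      unfolding torus_integral_cmult using q
      by (intro sum_nonneg mult_nonneg_nonneg sph_ker_power_positive w c) auto
    finally show ?thesis .
  qed
  ultimately show ?thesis
    by (intro LIMSEQ_le_const) auto
qed

section \<open>Fourier coefficients of holomorphic functions on circles\<close>

text \<open>Cauchy's formula gives the Fourier coefficient of \<open>l\<close> of index \<open>n\<close>, and Cauchy's theorem says
that the one of index \<open>-n\<close> vanishes. Together they yield the real part of \<open>l\<close>, because
\<open>2 Re a Re b = Re (a b) + Re (cnj a b)\<close>.\<close>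

lemma circle_coefficient:
  assumes holo: "l holomorphic_on ball 0 R" and r: "0 < r" "r < R"
    and L: "l has_fps_expansion L" and n: "n > 0"
  shows "((\<lambda>t. Re (x * cis (- (real n * t))) * Re (l (of_real r * cis t)))
      has_integral pi * Re (x * of_real r ^ n * fps_nth L n)) {0..2*pi}"
proof -
  have cis_pow: "cis t ^ n * cis (- (real n * t)) = 1" for t
    by (simp add: Complex.DeMoivre cis_mult)
  have "((\<lambda>u. l u / (u - 0) ^ Suc n) has_contour_integral
      2 * of_real pi * \<i> / fact n * (deriv ^^ n) l 0) (circlepath 0 r)"
    using Cauchy_has_contour_integral_higher_derivative_circlepath[of 0 r l 0 n] r
    by (force intro!: holomorphic_on_imp_continuous_on holomorphic_on_subset[OF holo])
  then have "((\<lambda>t. l (of_real r * cis t) / (of_real r * cis t) ^ Suc n * r * \<i> * cis t) has_integral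
      2 * of_real pi * \<i> * fps_nth L n) {0..2*pi}"
    using fps_nth_fps_expansion[OF L, of n]
    by (simp add: circlepath_def has_contour_integral_part_circlepath_iff)
  from has_integral_mult_right[OF this, of "x * of_real r ^ n / \<i>"]
  have neg: "((\<lambda>t. (x * cis (- (real n * t))) * l (of_real r * cis t)) has_integral
      2 * of_real pi * x * of_real r ^ n * fps_nth L n) {0..2*pi}"
  proof (rule has_integral_eq_rhs[OF has_integral_eq, rotated])
    fix t
    have "cis t ^ n \<noteq> 0" by simp
    then have "cis (- (real n * t)) = 1 / cis t ^ n"
      using cis_pow[of t] by (simp add: field_simps)
    then show "x * of_real r ^ n / \<i> * (l (of_real r * cis t) / (of_real r * cis t) ^ Suc n * r * \<i> * cis t)
        = (x * cis (- (real n * t))) * l (of_real r * cis t)"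
      using r by (simp add: power_mult_distrib field_simps)
  qed (simp add: field_simps)
  have "((\<lambda>u. l u * u ^ (n - 1)) has_contour_integral 0) (circlepath 0 r)"
    by (rule Cauchy_theorem_convex_simple[of _ "ball 0 R"])
       (use r in \<open>auto intro!: holomorphic_intros holo\<close>)
  then have "((\<lambda>t. l (of_real r * cis t) * (of_real r * cis t) ^ (n - 1) * r * \<i> * cis t) has_integral 0) {0..2*pi}"
    by (simp add: circlepath_def has_contour_integral_part_circlepath_iff)
  from has_integral_mult_right[OF this, of "cnj x / (of_real r ^ n * \<i>)"]
  have pos: "((\<lambda>t. cnj (x * cis (- (real n * t))) * l (of_real r * cis t)) has_integral 0) {0..2*pi}"
  proof (rule has_integral_eq_rhs[OF has_integral_eq, rotated])
    fix t
    have "cnj (cis (- (real n * t))) = cis t ^ n"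
      by (simp add: Complex.DeMoivre cis_cnj)
    moreover have "(of_real r * cis t) ^ (n - 1) * r * cis t = of_real r ^ n * cis t ^ n"
      using n by (cases n) (simp_all add: power_mult_distrib)
    ultimately show "cnj x / (of_real r ^ n * \<i>) * (l (of_real r * cis t) * (of_real r * cis t) ^ (n - 1) * r * \<i> * cis t)
        = cnj (x * cis (- (real n * t))) * l (of_real r * cis t)"
      using r by (simp add: field_simps)
  qed simp
  from has_integral_mult_right[OF has_integral_linear[OF has_integral_add[OF neg pos] bounded_linear_Re], of "1/2"]
  show ?thesis
    by (rule has_integral_eq_rhs[OF has_integral_eq, rotated]) (auto simp: algebra_simps)
qed

section \<open>Difference quotients of univalent functions\<close>

lemma exp_log_difference_quotient:
  assumes holo: "f holomorphic_on ball 0 1" and inj: "inj_on f (ball 0 1)" and \<zeta>: "\<zeta> \<in> ball 0 1"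
  shows "\<exists>l. l holomorphic_on ball 0 1 \<and> (\<forall>z\<in>ball 0 1. f z - f \<zeta> = (z - \<zeta>) * exp (l z))"
proof -
  let ?q = "\<lambda>z. if z = \<zeta> then deriv f \<zeta> else (f z - f \<zeta>) / (z - \<zeta>)"
  have q: "?q holomorphic_on ball 0 1"
    by (rule pole_lemma[OF holo]) (use \<zeta> in simp)
  have "deriv f \<zeta> \<noteq> 0"
    by (rule holomorphic_injective_imp_regular[OF holo _ inj \<zeta>]) simp
  then have nz: "?q z \<noteq> 0" if "z \<in> ball 0 1" for z
    using inj_onD[OF inj, of z \<zeta>] that \<zeta> by auto
  obtain l where "l holomorphic_on ball 0 1" "\<And>z. z \<in> ball 0 1 \<Longrightarrow> ?q z = exp (l z)"
    using contractible_imp_holomorphic_log[OF q _ nz] convex_imp_contractible[OF convex_ball] by metis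
  moreover have "f z - f \<zeta> = (z - \<zeta>) * exp (l z)" if "z \<in> ball 0 1" for z
    unfolding calculation(2)[OF that, symmetric] by simp
  ultimately show ?thesis by blast
qed

text \<open>The difference quotient \<open>exp (l z)\<close> and its inverse are holomorphic in \<open>z\<close>, so they are
bounded by their maximum on a larger circle. There \<open>z\<close> keeps away from \<open>\<zeta>\<close>, and
injectivity with compactness keeps \<open>f z\<close> away from \<open>f \<zeta>\<close>, uniformly in \<open>\<zeta>\<close>.\<close>

lemma univalent_bilipschitz:
  assumes holo: "f holomorphic_on ball 0 1" and inj: "inj_on f (ball 0 1)" and r: "0 < r" "r < 1"
  obtains m M where "m > 0" "M > 0"
    "\<And>z \<zeta>. cmod z \<le> r \<Longrightarrow> cmod \<zeta> \<le> r \<Longrightarrow> m * cmod (z - \<zeta>) \<le> cmod (f z - f \<zeta>)"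
    "\<And>z \<zeta>. cmod z \<le> r \<Longrightarrow> cmod \<zeta> \<le> r \<Longrightarrow> cmod (f z - f \<zeta>) \<le> M * cmod (z - \<zeta>)"
proof -
  define R where "R = (1 + r) / 2"
  have R: "r < R" "R < 1" "0 < R" using r by (auto simp: R_def)
  have cont: "continuous_on (cball 0 R) f"
    by (rule holomorphic_on_imp_continuous_on, rule holomorphic_on_subset[OF holo]) (use R in auto)
  have comp1: "compact (f ` sphere 0 R)" and comp2: "compact (f ` cball 0 r)" and comp3: "compact (f ` cball 0 R)"
    using R by (auto intro!: compact_continuous_image continuous_on_subset[OF cont])
  define d where "d = setdist (f ` sphere 0 R) (f ` cball 0 r)"
  have "f ` sphere 0 R \<inter> f ` cball 0 r = {}"
  proof -
    have "f z \<noteq> f \<zeta>" if "cmod z = R" "cmod \<zeta> \<le> r" for z \<zeta>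
      using inj_onD[OF inj, of z \<zeta>] that R by auto
    then show ?thesis by fastforce
  qed
  then have d: "d > 0"
    unfolding d_def using comp1 comp2 R r
    by (subst setdist_gt_0_compact_closed) (auto simp: compact_imp_closed)
  obtain K where K: "K > 0" "\<And>z. cmod z \<le> R \<Longrightarrow> cmod (f z) \<le> K"
    using compact_imp_bounded[OF comp3] unfolding bounded_pos by auto
  have main: "cmod (exp (l z)) \<le> 2 * K / (R - r) \<and> cmod (exp (- l z)) \<le> 2 / d"
    if \<zeta>: "cmod \<zeta> \<le> r" and l: "l holomorphic_on ball 0 1"
      and eq: "\<forall>z\<in>ball 0 1. f z - f \<zeta> = (z - \<zeta>) * exp (l z)" and z: "cmod z \<le> R" for \<zeta> l z
  proof -
    have hol: "l holomorphic_on ball 0 R" "continuous_on (cball 0 R) l"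
      using R by (auto intro!: holomorphic_on_imp_continuous_on holomorphic_on_subset[OF l])
    have edge: "cmod (exp (l u)) \<le> 2 * K / (R - r) \<and> cmod (exp (- l u)) \<le> 2 / d" if u: "cmod u = R" for u
    proof
      have u\<zeta>: "R - r \<le> cmod (u - \<zeta>)" "cmod (u - \<zeta>) \<le> 2"
        using norm_triangle_ineq2[of u \<zeta>] norm_triangle_ineq4[of u \<zeta>] u \<zeta> R r by linarith+
      have dle: "d \<le> cmod (f u - f \<zeta>)"
        unfolding d_def using setdist_le_dist[of "f u" "f ` sphere 0 R" "f \<zeta>" "f ` cball 0 r"] u \<zeta>
        by (auto simp: dist_norm)
      have Kle: "cmod (f u - f \<zeta>) \<le> 2 * K"
        using norm_triangle_ineq4[of "f u" "f \<zeta>"] K(2)[of u] K(2)[of \<zeta>] u \<zeta> R by linarith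
      have e: "cmod (f u - f \<zeta>) = cmod (u - \<zeta>) * cmod (exp (l u))"
        using eq u R by (simp add: norm_mult)
      have "(R - r) * cmod (exp (l u)) \<le> 2 * K"
        using mult_right_mono[OF u\<zeta>(1) norm_ge_zero[of "exp (l u)"]] e Kle by linarith
      then show "cmod (exp (l u)) \<le> 2 * K / (R - r)"
        using R by (simp add: field_simps)
      have dexp: "d \<le> 2 * cmod (exp (l u))"
        using mult_right_mono[OF u\<zeta>(2) norm_ge_zero[of "exp (l u)"]] e dle by linarith
      have "cmod (exp (- l u)) = 1 / cmod (exp (l u))"
        by (simp only: exp_minus norm_inverse divide_inverse mult_1)
      also have "\<dots> \<le> 1 / (d / 2)"
        using d dexp by (intro divide_left_mono) auto
      finally show "cmod (exp (- l u)) \<le> 2 / d"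
        by simp
    qed
    show ?thesis
    proof
      show "cmod (exp (l z)) \<le> 2 * K / (R - r)"
        by (rule maximum_modulus_frontier[of "\<lambda>z. exp (l z)" "cball 0 R"])
           (use hol z edge in \<open>auto intro!: holomorphic_intros continuous_intros simp: interior_cball\<close>)
      show "cmod (exp (- l z)) \<le> 2 / d"
        by (rule maximum_modulus_frontier[of "\<lambda>z. exp (- l z)" "cball 0 R"])
           (use hol z edge in \<open>auto intro!: holomorphic_intros continuous_intros simp: interior_cball\<close>)
    qed
  qed
  show ?thesis
  proof (rule that[of "d / 2" "2 * K / (R - r)"])
    show "d / 2 > 0" "2 * K / (R - r) > 0" using d K R by auto
    fix z \<zeta> assume z: "cmod z \<le> r" and \<zeta>: "cmod \<zeta> \<le> r"
    obtain l where l: "l holomorphic_on ball 0 1" "\<forall>z\<in>ball 0 1. f z - f \<zeta> = (z - \<zeta>) * exp (l z)"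
      using exp_log_difference_quotient[OF holo inj, of \<zeta>] \<zeta> r by auto
    have b: "cmod (exp (l z)) \<le> 2 * K / (R - r)" "cmod (exp (- l z)) \<le> 2 / d"
      using main[OF \<zeta> l, of z] z R by auto
    have e: "cmod (f z - f \<zeta>) = cmod (z - \<zeta>) * cmod (exp (l z))"
      using l(2) z r by (simp add: norm_mult)
    show "cmod (f z - f \<zeta>) \<le> 2 * K / (R - r) * cmod (z - \<zeta>)"
      unfolding e using mult_left_mono[OF b(1), of "cmod (z - \<zeta>)"] by (simp add: mult_ac)
    have "1 = cmod (exp (- l z)) * cmod (exp (l z))"
      by (simp flip: norm_mult exp_add del: norm_exp_eq_Re)
    also have "\<dots> \<le> 2 / d * cmod (exp (l z))"
      using b(2) by (intro mult_right_mono) auto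
    finally have "d / 2 \<le> cmod (exp (l z))"
      using d by (simp add: field_simps)
    then show "d / 2 * cmod (z - \<zeta>) \<le> cmod (f z - f \<zeta>)"
      unfolding e using mult_left_mono[of "d / 2" "cmod (exp (l z))" "cmod (z - \<zeta>)"] by (simp add: mult_ac)
  qed
qed

section \<open>Energy of a univalent image of a circle\<close>

text \<open>This expression is to the chord length \<open>|cis s - cis t|\<close> on the circle what
\<open>1 - q * sph_ker u v\<close> is to the chordal distance: a version of its square that does not vanish on
the diagonal.\<close>

lemma cmod_one_minus_cis_sq:
  "(cmod (1 - of_real \<rho> * cis (t - s)))\<^sup>2 = (1 - \<rho>)\<^sup>2 + \<rho> * (cmod (cis s - cis t))\<^sup>2"
proof -
  have ss: "cos s ^ 2 = 1 - sin s ^ 2" "cos t ^ 2 = 1 - sin t ^ 2" 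
    using sin_cos_squared_add[of s] sin_cos_squared_add[of t] by linarith+
  have expand: "(1 - \<rho> * x)\<^sup>2 + (\<rho> * y)\<^sup>2 = 1 - 2 * \<rho> * x + \<rho>\<^sup>2 * (x\<^sup>2 + y\<^sup>2)" for x y
    by (simp add: power2_eq_square algebra_simps)
  have "(cmod (1 - of_real \<rho> * cis (t - s)))\<^sup>2 = 1 - 2 * \<rho> * cos (t - s) + \<rho>\<^sup>2 * ((cos (t - s))\<^sup>2 + (sin (t - s))\<^sup>2)"
    unfolding expand[symmetric] cmod_power2 by simp
  also have "\<dots> = 1 - 2 * \<rho> * cos (t - s) + \<rho>\<^sup>2"
    by simp
  also have "cos (t - s) = 1 - (cmod (cis s - cis t))\<^sup>2 / 2"
    unfolding cmod_power2 cos_diff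
    by (simp add: power2_diff ss field_simps)
  finally show ?thesis
    by (simp add: power2_eq_square algebra_simps)
qed

lemma cis_eq_on_period:
  assumes "s \<in> {0..2*pi}" "t \<in> {0..2*pi}" "cis s = cis t"
  shows "t \<in> {s, s - 2*pi, s + 2*pi}"
proof -
  have "cos (t - s) = 1"
    using cmod_one_minus_cis_sq[of 1 t s] assms(3) by (simp add: complex_eq_iff)
  then obtain n :: int where n: "t - s = of_int n * 2 * pi"
    using cos_one_2pi_int by auto
  have "\<bar>t - s\<bar> \<le> 2 * pi"
    using assms(1,2) by auto
  then have "\<bar>real_of_int n\<bar> * (2 * pi) \<le> 1 * (2 * pi)"
    by (simp add: n abs_mult)
  then have "\<bar>real_of_int n\<bar> \<le> 1"
    by (rule mult_right_le_imp_le) simp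
  then have "n = 0 \<or> n = 1 \<or> n = -1" by linarith
  with n show ?thesis by auto
qed

text \<open>If two squared distances \<open>X\<close> and \<open>T\<close> are comparable, then their regularisations at the same
scale \<open>h\<close> are comparable uniformly in \<open>h\<close>. The chordal kernel with parameter
\<open>q = 1 - h\<^sup>2\<close> and the circle kernel with parameter \<open>\<rho> = 1 - h\<close> are paired because
both then have the additive term \<open>h\<^sup>2\<close>.\<close>

lemma log_ratio_bounded:
  fixes a b h :: real
  assumes "0 < a" "0 < b" "0 < h" "h < 1" "0 \<le> T" "a * T \<le> X" "X \<le> b * T"
  shows "\<bar>- ln (h\<^sup>2 + (1 - h\<^sup>2) * X) + ln (h\<^sup>2 + (1 - h) * T)\<bar> \<le> - ln (min 1 a) + ln (max 1 (2 * b))"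
proof -
  let ?p = "h\<^sup>2 + (1 - h\<^sup>2) * X" and ?q = "h\<^sup>2 + (1 - h) * T"
  have h: "0 < h\<^sup>2" "h\<^sup>2 < h" using assms by (auto simp: power2_eq_square)
  have X: "0 \<le> X" using assms by (smt (verit) mult_nonneg_nonneg)
  have q: "0 < ?q" using assms h by (intro add_pos_nonneg) auto
  have lower: "min 1 a * ?q \<le> ?p"
  proof -
    have "min 1 a * ((1 - h) * T) \<le> a * ((1 - h) * T)"
      using assms by (intro mult_right_mono) auto
    also have "\<dots> = (1 - h) * (a * T)" by simp
    also have "\<dots> \<le> (1 - h\<^sup>2) * X"
      using assms h X by (intro mult_mono) auto
    finally have "min 1 a * ((1 - h) * T) \<le> (1 - h\<^sup>2) * X" .
    moreover have "min 1 a * h\<^sup>2 \<le> 1 * h\<^sup>2"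
      by (intro mult_right_mono) auto
    ultimately show ?thesis by (simp add: distrib_left)
  qed
  have upper: "?p \<le> max 1 (2 * b) * ?q"
  proof -
    have "1 - h\<^sup>2 = (1 + h) * (1 - h)" by (simp add: power2_eq_square algebra_simps)
    also have "\<dots> \<le> 2 * (1 - h)" using assms by (intro mult_right_mono) auto
    finally have "(1 - h\<^sup>2) * X \<le> (2 * (1 - h)) * (b * T)"
      using assms X by (intro mult_mono) auto
    also have "\<dots> = (2 * b) * ((1 - h) * T)" by simp
    also have "\<dots> \<le> max 1 (2 * b) * ((1 - h) * T)"
      using assms by (intro mult_right_mono) auto
    finally have "(1 - h\<^sup>2) * X \<le> max 1 (2 * b) * ((1 - h) * T)" .
    moreover have "1 * h\<^sup>2 \<le> max 1 (2 * b) * h\<^sup>2"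
      by (intro mult_right_mono) auto
    ultimately show ?thesis by (simp add: distrib_left)
  qed
  have m: "0 < min 1 a" "0 < max 1 (2 * b)" using assms by auto
  have p: "0 < ?p" using lower m q by (smt (verit) mult_pos_pos)
  have "ln (min 1 a) + ln ?q \<le> ln ?p"
    using lower m q p by (subst ln_mult_pos [symmetric]) auto
  moreover have "ln ?p \<le> ln (max 1 (2 * b)) + ln ?q"
    using upper m q p by (subst ln_mult_pos [symmetric]) auto
  moreover have "ln (min 1 a) \<le> 0" "0 \<le> ln (max 1 (2 * b))"
    using m by auto
  ultimately show ?thesis by linarith
qed

text \<open>Both logarithms become singular on the diagonal as \<open>h\<close> tends to 0, but their singularities cancel:
the difference stays bounded because \<open>f\<close> is bi-Lipschitz on the closed disc of radius \<open>r\<close>.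
Thus bounded convergence suffices and the singular integrals themselves are never formed.\<close>

lemma regularised_energy_limit:
  assumes holo: "f holomorphic_on ball 0 1" and inj: "inj_on f (ball 0 1)" and r: "0 < r" "r < 1"
    and c: "continuous_on UNIV c" and cb: "\<And>t. \<bar>c t\<bar> \<le> C"
    and h: "\<And>n. 0 < h n" "\<And>n. h n < 1" "h \<longlonglongrightarrow> 0"
  defines "w \<equiv> \<lambda>t. f (of_real r * cis t)"
  shows "(\<lambda>n. torus_integral (\<lambda>s t. c s * c t *
       (- ln (1 - (1 - (h n)\<^sup>2) * sph_ker (w s) (w t)) + ln ((cmod (1 - of_real (1 - h n) * cis (t - s)))\<^sup>2))))
    \<longlonglongrightarrow> torus_integral (\<lambda>s t. c s * c t *
       - ln ((1 - sph_ker (w s) (w t)) / (cmod (cis s - cis t))\<^sup>2))"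
proof -
  obtain m M where mM: "m > 0" "M > 0"
    "\<And>z \<zeta>. cmod z \<le> r \<Longrightarrow> cmod \<zeta> \<le> r \<Longrightarrow> m * cmod (z - \<zeta>) \<le> cmod (f z - f \<zeta>)"
    "\<And>z \<zeta>. cmod z \<le> r \<Longrightarrow> cmod \<zeta> \<le> r \<Longrightarrow> cmod (f z - f \<zeta>) \<le> M * cmod (z - \<zeta>)"
    using univalent_bilipschitz[OF holo inj r] by metis
  have w: "continuous_on A w" for A
    unfolding w_def
    by (rule continuous_on_compose2[OF holomorphic_on_imp_continuous_on[OF holo]])
       (use r in \<open>auto intro!: continuous_intros simp: norm_mult\<close>)
  have C: "0 \<le> C" using cb[of 0] by linarith
  have "bounded (f ` cball 0 r)"
    by (intro compact_imp_bounded compact_continuous_image holomorphic_on_imp_continuous_on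
         holomorphic_on_subset[OF holo]) (use r in auto)
  then obtain K where "\<forall>y\<in>f ` cball 0 r. cmod y \<le> K"
    unfolding bounded_iff by blast
  then have K: "cmod (w t) \<le> K" for t
    unfolding w_def using r by (simp add: norm_mult)
  have K0: "0 \<le> K" using K[of 0] norm_ge_zero order_trans by blast
  define T where "T = (\<lambda>s t. (cmod (cis s - cis t))\<^sup>2)"
  define X where "X = (\<lambda>s t. 1 - sph_ker (w s) (w t))"
  \<comment> \<open>The constants that compare the chordal distance of the images (\<open>X\<close>) with the distance on the unit circle (\<open>T\<close>).\<close>
  define a where "a = (m * r)\<^sup>2 / (1 + K\<^sup>2)\<^sup>2"
  define b where "b = (M * r)\<^sup>2"
  have K2: "1 + K\<^sup>2 > 0" by (simp add: add_pos_nonneg)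
  have ab: "0 < a" "0 < b" using mM r K2 by (auto simp: a_def b_def)
  have XT: "a * T s t \<le> X s t" "X s t \<le> b * T s t" for s t
  proof -
    have rr: "cmod (of_real r * cis s - of_real r * cis t) = r * cmod (cis s - cis t)"
      using r by (simp flip: right_diff_distrib add: norm_mult)
    let ?D = "(1 + (cmod (w s))\<^sup>2) * (1 + (cmod (w t))\<^sup>2)"
    have D: "1 \<le> ?D" "?D \<le> (1 + K\<^sup>2)\<^sup>2"
    proof -
      have "1 * 1 \<le> ?D" by (intro mult_mono) auto
      then show "1 \<le> ?D" by simp
      show "?D \<le> (1 + K\<^sup>2)\<^sup>2"
        unfolding power2_eq_square[of "1 + K\<^sup>2"] using K by (intro mult_mono add_mono power_mono) auto
    qed
    have lo: "(m * r * cmod (cis s - cis t))\<^sup>2 \<le> (cmod (w s - w t))\<^sup>2"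
      using mM(3)[of "of_real r * cis s" "of_real r * cis t"] r mM(1) unfolding rr w_def
      by (intro power_mono) (auto simp: norm_mult mult_ac)
    have up: "(cmod (w s - w t))\<^sup>2 \<le> (M * r * cmod (cis s - cis t))\<^sup>2"
      using mM(4)[of "of_real r * cis s" "of_real r * cis t"] r unfolding rr w_def
      by (intro power_mono) (auto simp: norm_mult mult_ac)
    have "a * T s t = (m * r * cmod (cis s - cis t))\<^sup>2 / (1 + K\<^sup>2)\<^sup>2"
      by (simp add: a_def T_def power_mult_distrib)
    also have "\<dots> \<le> (cmod (w s - w t))\<^sup>2 / ?D"
      using D lo by (intro frac_le) auto
    finally show "a * T s t \<le> X s t"
      by (simp add: X_def one_minus_sph_ker)
    have "(cmod (w s - w t))\<^sup>2 / ?D \<le> (cmod (w s - w t))\<^sup>2 / 1"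
      using D by (intro divide_left_mono) auto
    also have "\<dots> \<le> b * T s t"
      using up by (simp add: b_def T_def power_mult_distrib)
    finally show "X s t \<le> b * T s t"
      by (simp add: X_def one_minus_sph_ker)
  qed
  define D where "D = (\<lambda>n s t. - ln ((h n)\<^sup>2 + (1 - (h n)\<^sup>2) * X s t) + ln ((h n)\<^sup>2 + (1 - h n) * T s t))"
  have D_eq: "- ln (1 - (1 - (h n)\<^sup>2) * sph_ker (w s) (w t)) + ln ((cmod (1 - of_real (1 - h n) * cis (t - s)))\<^sup>2)
      = D n s t" for n s t
    unfolding D_def X_def T_def cmod_one_minus_cis_sq by (simp add: algebra_simps)
  have D_bound: "\<bar>D n s t\<bar> \<le> - ln (min 1 a) + ln (max 1 (2 * b))" for n s t
    unfolding D_def using ab h XT by (intro log_ratio_bounded) (auto simp: T_def)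
  have T0: "0 \<le> T s t" and X0: "0 \<le> X s t" for s t
    using sph_ker_le_1[of "w s" "w t"] by (auto simp: T_def X_def)
  have "(\<lambda>n. torus_integral (\<lambda>s t. c s * c t * D n s t))
      \<longlonglongrightarrow> torus_integral (\<lambda>s t. c s * c t * - ln (X s t / T s t))"
  proof (rule torus_bounded_convergence[where N = "\<lambda>s. {s, s - 2*pi, s + 2*pi}" and
        B = "C * C * (- ln (min 1 a) + ln (max 1 (2 * b)))"])
    fix n
    have h2: "0 < (h n)\<^sup>2" "(h n)\<^sup>2 < 1"
      using h(1,2)[of n] by (auto simp: power_less_one_iff)
    have nz: "(h n)\<^sup>2 + (1 - (h n)\<^sup>2) * X s t \<noteq> 0" "(h n)\<^sup>2 + (1 - h n) * T s t \<noteq> 0" for s t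
      using h2 h(2)[of n] X0[of s t] T0[of s t]
      by (metis add_pos_nonneg diff_ge_0_iff_ge less_eq_real_def mult_nonneg_nonneg less_irrefl)+
    show "continuous_on UNIV (\<lambda>p. c (fst p) * c (snd p) * D n (fst p) (snd p))"
      unfolding D_def
      by (intro continuous_intros continuous_on_comp_fst_snd c; use nz in
          \<open>auto simp: X_def T_def intro!: continuous_intros continuous_on_sph_ker continuous_on_comp_fst_snd w\<close>)
    fix s t
    show "\<bar>c s * c t * D n s t\<bar> \<le> C * C * (- ln (min 1 a) + ln (max 1 (2 * b)))"
      unfolding abs_mult using cb C D_bound by (intro mult_mono) auto
  next
    fix s t assume "s \<in> {0..2*pi}" "t \<in> {0..2*pi} - {s, s - 2*pi, s + 2*pi}"
    then have "cis s \<noteq> cis t" using cis_eq_on_period[of s t] by blast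
    then have T: "0 < T s t" by (simp add: T_def)
    have X: "0 < X s t" using XT(1)[of s t] mult_pos_pos[OF ab(1) T] by linarith
    have "(\<lambda>n. D n s t) \<longlonglongrightarrow> - ln (0\<^sup>2 + (1 - 0\<^sup>2) * X s t) + ln (0\<^sup>2 + (1 - 0) * T s t)"
      unfolding D_def using X T by (intro tendsto_intros h(3)) auto
    then have "(\<lambda>n. D n s t) \<longlonglongrightarrow> - ln (X s t / T s t)"
      using X T by (simp add: ln_div)
    then show "(\<lambda>n. c s * c t * D n s t) \<longlonglongrightarrow> c s * c t * - ln (X s t / T s t)"
      by (intro tendsto_intros)
  qed auto
  then show ?thesis
    by (simp only: D_eq X_def T_def)
qed

section \<open>The Grunsky inequality\<close>

text \<open>The densities used as charges on the circle: real trigonometric polynomials, which have total mass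
0 as soon as \<open>S\<close> does not contain 0.\<close>

definition trig_density :: "nat set \<Rightarrow> (nat \<Rightarrow> complex) \<Rightarrow> real \<Rightarrow> real" where
  "trig_density S x t = (\<Sum>n\<in>S. Re (x n * cis (- (real n * t))))"

lemma continuous_on_trig_density: "continuous_on A (trig_density S x)"
  unfolding trig_density_def by (intro continuous_intros)

lemma trig_density_bounded: "\<bar>trig_density S x t\<bar> \<le> (\<Sum>n\<in>S. cmod (x n))"
  unfolding trig_density_def
proof (rule order_trans[OF sum_abs sum_mono])
  fix n
  show "\<bar>Re (x n * cis (- (real n * t)))\<bar> \<le> cmod (x n)"
    using abs_Re_le_cmod[of "x n * cis (- (real n * t))"] by (simp add: norm_mult)
qed

lemma trig_density_integral:
  assumes "0 \<notin> S" "finite S"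
    and "l holomorphic_on ball 0 R" "0 < r" "r < R" "l has_fps_expansion L"
  shows "((\<lambda>t. trig_density S x t * Re (l (of_real r * cis t)))
      has_integral pi * Re (\<Sum>n\<in>S. x n * of_real r ^ n * fps_nth L n)) {0..2*pi}"
proof -
  have "((\<lambda>t. \<Sum>n\<in>S. Re (x n * cis (- (real n * t))) * Re (l (of_real r * cis t)))
      has_integral (\<Sum>n\<in>S. pi * Re (x n * of_real r ^ n * fps_nth L n))) {0..2*pi}"
    using assms by (intro has_integral_sum circle_coefficient[of l R]) (auto intro: gr0I)
  then show ?thesis
    by (simp add: trig_density_def sum_distrib_left sum_distrib_right)
qed

lemma trig_density_total:
  assumes "0 \<notin> S" "finite S"
  shows "(trig_density S x has_integral 0) {0..2*pi}"
proof -
  have "fps_nth (1 :: complex fps) n = 0" if "n \<in> S" for n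
    using assms that by (cases n) auto
  then have "(\<Sum>n\<in>S. x n * of_real 1 ^ n * fps_nth 1 n) = 0"
    by (simp add: sum.neutral)
  then show ?thesis
    using trig_density_integral[OF assms, of "\<lambda>_. 1" 2 1 1 x] by simp
qed

lemma has_fps_expansion_Ln_one_minus:
  fixes a :: complex
  shows "(\<lambda>z. Ln (1 - a * z)) has_fps_expansion Abs_fps (\<lambda>n. - (a ^ n) / of_nat n)"
proof (rule has_fps_expansionI)
  have "eventually (\<lambda>z. z \<in> (\<lambda>z. a * z) -` ball 0 1) (nhds 0)"
    by (intro eventually_nhds_in_open continuous_open_vimage continuous_intros) auto
  then show "\<forall>\<^sub>F z in nhds 0. (\<lambda>n. fps_nth (Abs_fps (\<lambda>n. - (a ^ n) / of_nat n)) n * z ^ n) sums Ln (1 - a * z)"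
  proof eventually_elim
    case (elim z)
    then show ?case
      using Ln_series'[of "- (a * z)"] by (simp add: power_mult_distrib)
  qed
qed

text \<open>For fixed \<open>s\<close> the kernel is twice the real part of a branch of \<open>Ln (1 - a z)\<close> on the unit circle,
with \<open>a = \<rho> cis (-s)\<close>. This function is holomorphic on a disc of radius \<open>1 / \<rho> > 1\<close>, so
the Fourier coefficients can be read off its power series.\<close>

lemma circle_self_energy:
  assumes S: "0 \<notin> S" "finite S" and \<rho>: "0 < \<rho>" "\<rho> < 1"
  shows "torus_integral (\<lambda>s t. trig_density S x s * trig_density S x t * ln ((cmod (1 - of_real \<rho> * cis (t - s)))\<^sup>2))
    = - 2 * pi\<^sup>2 * (\<Sum>n\<in>S. \<rho> ^ n * (cmod (x n))\<^sup>2 / n)"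
proof -
  let ?c = "trig_density S x"
  have inner: "integral {0..2*pi} (\<lambda>t. ?c s * ?c t * ln ((cmod (1 - of_real \<rho> * cis (t - s)))\<^sup>2))
      = ?c s * Re (\<Sum>n\<in>S. of_real (- 2 * pi * \<rho> ^ n / n) * cnj (x n) * (of_real 1 * cis s) ^ n)" for s
  proof -
    define a where "a = of_real \<rho> * cis (- s)"
    have az: "cmod (a * z) < 1" if "z \<in> ball 0 (1 / \<rho>)" for z
      using that \<rho> by (simp add: a_def norm_mult field_simps)
    have Re1: "1 - a * z \<notin> \<real>\<^sub>\<le>\<^sub>0" if "z \<in> ball 0 (1 / \<rho>)" for z
    proof -
      have "Re (a * z) < 1"
        using az[OF that] complex_Re_le_cmod[of "a * z"] by linarith
      then show ?thesis by (auto simp: complex_nonpos_Reals_iff)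
    qed
    have "((\<lambda>t. ?c t * Re (Ln (1 - a * (of_real 1 * cis t)))) has_integral
        pi * Re (\<Sum>n\<in>S. x n * of_real 1 ^ n * fps_nth (Abs_fps (\<lambda>n. - (a ^ n) / of_nat n)) n)) {0..2*pi}"
      by (rule trig_density_integral[OF S _ _ _ has_fps_expansion_Ln_one_minus, of _ "1/\<rho>"])
         (use Re1 \<rho> in \<open>auto intro!: holomorphic_intros\<close>)
    from has_integral_mult_right[OF this, of "2 * ?c s"]
    have "((\<lambda>t. ?c s * ?c t * ln ((cmod (1 - of_real \<rho> * cis (t - s)))\<^sup>2)) has_integral
        ?c s * (2 * pi * Re (\<Sum>n\<in>S. - (x n * a ^ n / of_nat n)))) {0..2*pi}"
    proof (rule has_integral_eq_rhs[OF has_integral_eq, rotated])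
      fix t
      have at: "of_real \<rho> * cis (t - s) = a * cis t"
        by (simp add: a_def cis_mult mult.assoc)
      have "1 - a * cis t \<noteq> 0"
        using az[of "cis t"] \<rho> by auto
      then show "2 * ?c s * (?c t * Re (Ln (1 - a * (of_real 1 * cis t)))) =
          ?c s * ?c t * ln ((cmod (1 - of_real \<rho> * cis (t - s)))\<^sup>2)"
        unfolding at by (simp add: ln_realpow)
    qed simp
    then have "integral {0..2*pi} (\<lambda>t. ?c s * ?c t * ln ((cmod (1 - of_real \<rho> * cis (t - s)))\<^sup>2))
       = ?c s * (2 * pi * Re (\<Sum>n\<in>S. - (x n * a ^ n / of_nat n)))"
      by (rule integral_unique)
    also have "2 * pi * Re (\<Sum>n\<in>S. - (x n * a ^ n / of_nat n))
        = (\<Sum>n\<in>S. - 2 * pi / n * Re (x n * a ^ n))"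
      by (simp add: sum_distrib_left sum_negf Re_divide_of_nat)
    also have "\<dots> = (\<Sum>n\<in>S. Re (of_real (- 2 * pi * \<rho> ^ n / n) * cnj (x n) * (of_real 1 * cis s) ^ n))"
    proof (intro sum.cong refl)
      fix n
      have "x n * a ^ n = of_real (\<rho> ^ n) * (x n * cis (- (n * s)))"
        by (simp add: a_def power_mult_distrib Complex.DeMoivre)
      then have "Re (x n * a ^ n) = \<rho> ^ n * Re (x n * cis (- (n * s)))"
        by (simp only: Re_complex_of_real times_complex.sel Im_complex_of_real)
      moreover have "of_real (- 2 * pi * \<rho> ^ n / n) * cnj (x n) * (of_real 1 * cis s) ^ n
          = of_real (- 2 * pi * \<rho> ^ n / n) * cnj (x n * cis (- (n * s)))"
        by (simp add: Complex.DeMoivre cis_cnj)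
      moreover have "Re (of_real y * cnj z) = y * Re z" for y z by simp
      ultimately show "- 2 * pi / n * Re (x n * a ^ n) = Re (of_real (- 2 * pi * \<rho> ^ n / n) * cnj (x n) * (of_real 1 * cis s) ^ n)"
        by (simp only:) simp
    qed
    finally show ?thesis by (simp only: Re_sum)
  qed
  let ?L = "\<Sum>n\<in>S. fps_const (of_real (- 2 * pi * \<rho> ^ n / n) * cnj (x n)) * fps_X ^ n"
  have coeff: "fps_nth ?L m = of_real (- 2 * pi * \<rho> ^ m / m) * cnj (x m)" if "m \<in> S" for m
  proof -
    have "fps_nth ?L m = (\<Sum>n\<in>S. if m = n then of_real (- 2 * pi * \<rho> ^ n / n) * cnj (x n) else 0)"
      unfolding fps_sum_nth by (intro sum.cong) (auto simp: fps_X_power_nth)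
    then show ?thesis
      using that S by simp
  qed
  have "((\<lambda>s. ?c s * Re (\<Sum>n\<in>S. of_real (- 2 * pi * \<rho> ^ n / n) * cnj (x n) * (of_real 1 * cis s) ^ n)) has_integral
     pi * Re (\<Sum>n\<in>S. x n * of_real 1 ^ n * fps_nth ?L n)) {0..2*pi}"
  proof (rule trig_density_integral[OF S, where R = 2])
    show "(\<lambda>z. \<Sum>n\<in>S. of_real (- 2 * pi * \<rho> ^ n / n) * cnj (x n) * z ^ n) has_fps_expansion ?L"
      by (intro fps_expansion_intros)
    show "(\<lambda>z. \<Sum>n\<in>S. of_real (- 2 * pi * \<rho> ^ n / n) * cnj (x n) * z ^ n) holomorphic_on ball 0 2"
      by (intro holomorphic_intros)
  qed auto
  moreover have "pi * Re (\<Sum>n\<in>S. x n * of_real 1 ^ n * fps_nth ?L n)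
      = - 2 * pi\<^sup>2 * (\<Sum>n\<in>S. \<rho> ^ n * (cmod (x n))\<^sup>2 / n)"
  proof -
    have "Re (x n * of_real 1 ^ n * fps_nth ?L n) = - 2 * pi * (\<rho> ^ n * (cmod (x n))\<^sup>2 / n)" if "n \<in> S" for n
    proof -
      have "x n * of_real 1 ^ n * fps_nth ?L n = of_real (- 2 * pi * \<rho> ^ n / n) * (x n * cnj (x n))"
        unfolding coeff[OF that] by simp
      also have "x n * cnj (x n) = of_real ((cmod (x n))\<^sup>2)"
        by (rule complex_norm_square [symmetric])
      finally show ?thesis
        by (simp flip: of_real_mult of_real_power)
    qed
    then have "Re (\<Sum>n\<in>S. x n * of_real 1 ^ n * fps_nth ?L n) = (\<Sum>n\<in>S. - 2 * pi * (\<rho> ^ n * (cmod (x n))\<^sup>2 / n))"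
      unfolding Re_sum by (intro sum.cong) auto
    also have "\<dots> = - 2 * pi * (\<Sum>n\<in>S. \<rho> ^ n * (cmod (x n))\<^sup>2 / n)"
      by (rule sum_distrib_left [symmetric])
    finally show ?thesis by (simp add: power2_eq_square)
  qed
  ultimately show ?thesis
    unfolding torus_integral_def inner by (simp add: integral_unique)
qed

text \<open>The quotient of the squared distances is \<open>r\<^sup>2\<close> times the squared modulus of the difference
quotient of \<open>f\<close>, divided by a function of \<open>s\<close> and a function of \<open>t\<close>. Its logarithm is
therefore the real part of a holomorphic function of either point, plus terms that depend on one
variable only and disappear because the charge has total mass 0. The functions \<open>k n\<close> are the Taylor
coefficients, in one variable, of the logarithm of the difference quotient; if \<open>f 0 = 0\<close>, then
\<open>n * k n \<zeta>\<close> is \<open>1 / \<zeta> ^ n\<close> minus a Faber polynomial at \<open>1 / f \<zeta>\<close>.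
Taking coefficients again gives the Grunsky coefficients.
The origin is excluded for \<open>\<zeta>\<close> because the explicit formulas for \<open>k n\<close> have a removable
singularity there.\<close>

lemma image_energy:
  assumes S: "0 \<notin> S" "finite S"
    and holo: "f holomorphic_on ball 0 1" and inj: "inj_on f (ball 0 1)" and r: "0 < r" "r < 1"
    and k: "\<And>n. n \<in> S \<Longrightarrow> k n holomorphic_on ball 0 1"
    and coeff: "\<And>n \<zeta> l L. \<lbrakk>n \<in> S; \<zeta> \<in> ball 0 1 - {0}; l holomorphic_on ball 0 1;
        \<forall>z\<in>ball 0 1. f z - f \<zeta> = (z - \<zeta>) * exp (l z); l has_fps_expansion L\<rbrakk> \<Longrightarrow> fps_nth L n = k n \<zeta>"
  defines "w \<equiv> \<lambda>t. f (of_real r * cis t)"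
  shows "torus_integral (\<lambda>s t. trig_density S x s * trig_density S x t *
       - ln ((1 - sph_ker (w s) (w t)) / (cmod (cis s - cis t))\<^sup>2))
    = - 2 * pi\<^sup>2 * Re (\<Sum>m\<in>S. \<Sum>n\<in>S. x m * x n * of_real r ^ (m + n) * fps_nth (fps_expansion (k n) 0) m)"
proof -
  let ?c = "trig_density S x"
  have w: "continuous_on A w" for A
    unfolding w_def
    by (rule continuous_on_compose2[OF holomorphic_on_imp_continuous_on[OF holo]])
       (use r in \<open>auto intro!: continuous_intros simp: norm_mult\<close>)
  define A where "A = (\<lambda>t. ln (1 + (cmod (w t))\<^sup>2))"
  have A: "continuous_on B A" for B
    unfolding A_def by (intro continuous_intros w) simp
  define \<alpha> where "\<alpha> = integral {0..2*pi} (\<lambda>t. ?c t * A t)"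
  have \<alpha>: "((\<lambda>t. ?c t * A t) has_integral \<alpha>) {0..2*pi}"
    unfolding \<alpha>_def
    by (intro integrable_integral integrable_continuous_interval continuous_intros continuous_on_trig_density A)
  let ?H = "\<lambda>z. \<Sum>n\<in>S. x n * of_real r ^ n * k n z"
  have inner: "integral {0..2*pi} (\<lambda>t. ?c s * ?c t * - ln ((1 - sph_ker (w s) (w t)) / (cmod (cis s - cis t))\<^sup>2))
      = ?c s * \<alpha> - 2 * pi * (?c s * Re (?H (of_real r * cis s)))" if s: "s \<in> {0..2*pi}" for s
  proof -
    define \<zeta> where "\<zeta> = of_real r * cis s"
    have \<zeta>: "\<zeta> \<in> ball 0 1 - {0}" using r by (auto simp: \<zeta>_def norm_mult)
    obtain l where l: "l holomorphic_on ball 0 1" "\<forall>z\<in>ball 0 1. f z - f \<zeta> = (z - \<zeta>) * exp (l z)"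
      using exp_log_difference_quotient[OF holo inj, of \<zeta>] \<zeta> by auto
    define L where "L = fps_expansion l 0"
    have L: "l has_fps_expansion L"
      unfolding L_def by (rule has_fps_expansion_fps_expansion[OF _ _ l(1)]) auto
    have Re_l: "((\<lambda>t. ?c t * Re (l (of_real r * cis t))) has_integral
        pi * Re (\<Sum>n\<in>S. x n * of_real r ^ n * fps_nth L n)) {0..2*pi}"
      by (rule trig_density_integral[OF S l(1) r L])
    have "((\<lambda>t. ?c s * (?c t * A t) + (?c s * (A s - 2 * ln r)) * ?c t + (- 2 * ?c s) * (?c t * Re (l (of_real r * cis t))))
       has_integral ?c s * \<alpha> + (?c s * (A s - 2 * ln r)) * 0 + (- 2 * ?c s) * (pi * Re (\<Sum>n\<in>S. x n * of_real r ^ n * fps_nth L n))) {0..2*pi}"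
      by (intro has_integral_add has_integral_mult_right \<alpha> trig_density_total[OF S] Re_l)
    moreover have "(\<Sum>n\<in>S. x n * of_real r ^ n * fps_nth L n) = ?H \<zeta>"
      by (intro sum.cong refl) (simp add: coeff[OF _ \<zeta> l L])
    ultimately have "((\<lambda>t. ?c s * (?c t * A t) + (?c s * (A s - 2 * ln r)) * ?c t + (- 2 * ?c s) * (?c t * Re (l (of_real r * cis t))))
       has_integral ?c s * \<alpha> - 2 * pi * (?c s * Re (?H \<zeta>))) {0..2*pi}"
      by (simp only:) (simp add: mult_ac)
    then have "((\<lambda>t. ?c s * ?c t * - ln ((1 - sph_ker (w s) (w t)) / (cmod (cis s - cis t))\<^sup>2))
       has_integral ?c s * \<alpha> - 2 * pi * (?c s * Re (?H \<zeta>))) {0..2*pi}"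
    \<comment> \<open>Off these three points \<open>cis s \<noteq> cis t\<close>; on them the quotient has denominator 0.\<close>
    proof (rule has_integral_spike[of "{s, s - 2*pi, s + 2*pi}", rotated 2])
      fix t assume "t \<in> {0..2*pi} - {s, s - 2*pi, s + 2*pi}"
      then have ne: "cis s \<noteq> cis t" using cis_eq_on_period[of s t] s by blast
      have "w t - w s = (of_real r * cis t - \<zeta>) * exp (l (of_real r * cis t))"
        using l(2) r by (auto simp: w_def \<zeta>_def norm_mult)
      then have "cmod (w s - w t) = r * cmod (cis s - cis t) * exp (Re (l (of_real r * cis t)))"
        using r by (simp add: \<zeta>_def norm_minus_commute[of "w s"] norm_minus_commute[of "cis s"] norm_mult flip: right_diff_distrib)
      then have quot: "(1 - sph_ker (w s) (w t)) / (cmod (cis s - cis t))\<^sup>2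
          = (r * exp (Re (l (of_real r * cis t))))\<^sup>2 / ((1 + (cmod (w s))\<^sup>2) * (1 + (cmod (w t))\<^sup>2))"
        using ne by (simp add: one_minus_sph_ker power_mult_distrib)
      have pos: "1 + (cmod u)\<^sup>2 > 0" for u by (simp add: add_pos_nonneg)
      have ln_quot: "ln ((1 - sph_ker (w s) (w t)) / (cmod (cis s - cis t))\<^sup>2)
          = 2 * (ln r + Re (l (of_real r * cis t))) - (A s + A t)"
        unfolding quot A_def using r pos[of "w s"] pos[of "w t"]
        by (simp add: ln_div ln_mult_pos ln_realpow)
      show "?c s * ?c t * - ln ((1 - sph_ker (w s) (w t)) / (cmod (cis s - cis t))\<^sup>2) =
          ?c s * (?c t * A t) + (?c s * (A s - 2 * ln r)) * ?c t + (- 2 * ?c s) * (?c t * Re (l (of_real r * cis t)))"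
        unfolding ln_quot by (simp add: algebra_simps)
    qed (simp add: negligible_finite)
    then show ?thesis
      unfolding \<zeta>_def by (rule integral_unique)
  qed
  let ?K = "\<Sum>n\<in>S. fps_const (x n * of_real r ^ n) * fps_expansion (k n) 0"
  have "((\<lambda>s. ?c s * Re (?H (of_real r * cis s))) has_integral
     pi * Re (\<Sum>m\<in>S. x m * of_real r ^ m * fps_nth ?K m)) {0..2*pi}"
  proof (rule trig_density_integral[OF S _ r])
    show "?H holomorphic_on ball 0 1"
      by (intro holomorphic_intros k)
    show "?H has_fps_expansion ?K"
      by (intro fps_expansion_intros has_fps_expansion_fps_expansion[OF _ _ k]) auto
  qed
  from has_integral_diff[OF has_integral_mult_left[OF trig_density_total[OF S, of x], of \<alpha>] has_integral_mult_right[OF this, of "2*pi"]]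
  have outer: "((\<lambda>s. ?c s * \<alpha> - 2 * pi * (?c s * Re (?H (of_real r * cis s)))) has_integral
     - 2 * pi\<^sup>2 * Re (\<Sum>m\<in>S. x m * of_real r ^ m * fps_nth ?K m)) {0..2*pi}"
    by (rule has_integral_eq_rhs) (simp add: power2_eq_square del: Re_sum)
  have double: "(\<Sum>m\<in>S. x m * of_real r ^ m * fps_nth ?K m)
      = (\<Sum>m\<in>S. \<Sum>n\<in>S. x m * x n * of_real r ^ (m + n) * fps_nth (fps_expansion (k n) 0) m)"
    by (simp add: fps_sum_nth sum_distrib_left power_add mult_ac)
  have "torus_integral (\<lambda>s t. ?c s * ?c t * - ln ((1 - sph_ker (w s) (w t)) / (cmod (cis s - cis t))\<^sup>2))
      = integral {0..2*pi} (\<lambda>s. ?c s * \<alpha> - 2 * pi * (?c s * Re (?H (of_real r * cis s))))"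
    unfolding torus_integral_def by (rule integral_cong) (rule inner)
  then show ?thesis
    by (simp only: integral_unique[OF outer] double)
qed

text \<open>The energy of the charge transported to the image of the circle of radius \<open>r\<close> is nonnegative. It
splits into the energy on the circle itself, which produces the right-hand side, and the contribution
of the difference quotient, which produces the Grunsky form with the factors \<open>r ^ (m + n)\<close>. Letting
\<open>r\<close> tend to 1 removes these factors.\<close>

theorem grunsky_inequality:
  assumes S: "0 \<notin> S" "finite S"
    and holo: "f holomorphic_on ball 0 1" and inj: "inj_on f (ball 0 1)"
    and k: "\<And>n. n \<in> S \<Longrightarrow> k n holomorphic_on ball 0 1"
    and coeff: "\<And>n \<zeta> l L. \<lbrakk>n \<in> S; \<zeta> \<in> ball 0 1 - {0}; l holomorphic_on ball 0 1;
        \<forall>z\<in>ball 0 1. f z - f \<zeta> = (z - \<zeta>) * exp (l z); l has_fps_expansion L\<rbrakk> \<Longrightarrow> fps_nth L n = k n \<zeta>"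
  shows "Re (\<Sum>m\<in>S. \<Sum>n\<in>S. x m * x n * fps_nth (fps_expansion (k n) 0) m) \<le> (\<Sum>n\<in>S. (cmod (x n))\<^sup>2 / n)"
proof -
  let ?c = "trig_density S x"
  let ?G = "\<lambda>r. Re (\<Sum>m\<in>S. \<Sum>n\<in>S. x m * x n * of_real r ^ (m + n) * fps_nth (fps_expansion (k n) 0) m)"
  let ?E = "\<lambda>\<rho>. \<Sum>n\<in>S. \<rho> ^ n * (cmod (x n))\<^sup>2 / n"
  have disc: "?G r \<le> ?E 1" if r: "0 < r" "r < 1" for r
  proof -
    define w where "w = (\<lambda>t. f (of_real r * cis t))"
    have w: "continuous_on UNIV w"
      unfolding w_def
      by (rule continuous_on_compose2[OF holomorphic_on_imp_continuous_on[OF holo]])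
         (use r in \<open>auto intro!: continuous_intros simp: norm_mult\<close>)
    \<comment> \<open>Any null sequence in the open unit interval serves as regularisation scale.\<close>
    define h where "h = (\<lambda>n::nat. 1 / (real n + 2))"
    have h: "0 < h n" "h n < 1" for n by (auto simp: h_def)
    have h0: "h \<longlonglongrightarrow> 0" unfolding h_def by real_asymp
    let ?N = "\<lambda>n s t. - ln (1 - (1 - (h n)\<^sup>2) * sph_ker (w s) (w t))"
    let ?C = "\<lambda>n s t. ln ((cmod (1 - of_real (1 - h n) * cis (t - s)))\<^sup>2)"
    have "torus_integral (\<lambda>s t. ?c s * ?c t * - ln ((1 - sph_ker (w s) (w t)) / (cmod (cis s - cis t))\<^sup>2))
        = - 2 * pi\<^sup>2 * ?G r"
      unfolding w_def by (rule image_energy[OF S holo inj r k coeff])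
    moreover have "(\<lambda>n. torus_integral (\<lambda>s t. ?c s * ?c t * (?N n s t + ?C n s t)))
        \<longlonglongrightarrow> torus_integral (\<lambda>s t. ?c s * ?c t * - ln ((1 - sph_ker (w s) (w t)) / (cmod (cis s - cis t))\<^sup>2))"
      unfolding w_def
      by (rule regularised_energy_limit[OF holo inj r continuous_on_trig_density trig_density_bounded h h0])
    ultimately have lim: "(\<lambda>n. torus_integral (\<lambda>s t. ?c s * ?c t * (?N n s t + ?C n s t)))
        \<longlonglongrightarrow> - 2 * pi\<^sup>2 * ?G r"
      by (simp only:)
    have lower: "- 2 * pi\<^sup>2 * ?E (1 - h n) \<le> torus_integral (\<lambda>s t. ?c s * ?c t * (?N n s t + ?C n s t))" for n
    proof -
      have h2: "0 \<le> 1 - (h n)\<^sup>2" "1 - (h n)\<^sup>2 < 1"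
        using h[of n] by (auto simp: power_le_one)
      have c: "continuous_on UNIV (\<lambda>p::real\<times>real. ?c (fst p) * ?c (snd p))"
        by (intro continuous_intros continuous_on_comp_fst_snd continuous_on_trig_density)
      have N: "continuous_on UNIV (\<lambda>p. ?N n (fst p) (snd p))"
      proof -
        have "1 - (1 - (h n)\<^sup>2) * sph_ker u v > 0" for u v
          using mult_left_le[OF sph_ker_le_1[of u v] h2(1)] h2(2) by linarith
        then show ?thesis
          by (intro continuous_intros continuous_on_sph_ker continuous_on_comp_fst_snd w) (auto simp: less_imp_neq[symmetric])
      qed
      have C: "continuous_on UNIV (\<lambda>p. ?C n (fst p) (snd p))"
      proof -
        have "1 - of_real (1 - h n) * cis t \<noteq> 0" for t
        proof
          assume "1 - of_real (1 - h n) * cis t = 0"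
          then have "cmod (of_real (1 - h n) * cis t) = cmod 1" by simp
          then have "\<bar>1 - h n\<bar> = 1"
            unfolding norm_mult norm_of_real norm_cis by simp
          then show False using h[of n] by linarith
        qed
        then show ?thesis
          by (intro continuous_intros) auto
      qed
      have "torus_integral (\<lambda>s t. ?c s * ?c t * (?N n s t + ?C n s t))
          = torus_integral (\<lambda>s t. ?c s * ?c t * ?N n s t) + torus_integral (\<lambda>s t. ?c s * ?c t * ?C n s t)"
        unfolding distrib_left
        by (rule torus_integral_add; rule continuous_on_mult[OF c]; rule N C)
      moreover have "0 \<le> torus_integral (\<lambda>s t. ?c s * ?c t * ?N n s t)"
        by (rule log_sph_ker_positive[OF w continuous_on_trig_density trig_density_bounded h2])
      moreover have "torus_integral (\<lambda>s t. ?c s * ?c t * ?C n s t) = - 2 * pi\<^sup>2 * ?E (1 - h n)"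
        using h[of n] by (intro circle_self_energy S) auto
      ultimately show ?thesis by linarith
    qed
    have "(\<lambda>n. - 2 * pi\<^sup>2 * ?E (1 - h n)) \<longlonglongrightarrow> - 2 * pi\<^sup>2 * ?E (1 - 0)"
      unfolding divide_inverse by (intro tendsto_intros h0)
    then have "- 2 * pi\<^sup>2 * ?E (1 - 0) \<le> - 2 * pi\<^sup>2 * ?G r"
      by (rule LIMSEQ_le[OF _ lim]) (use lower in blast)
    then show ?thesis by simp
  qed
  define r where "r = (\<lambda>n::nat. 1 - 1 / (real n + 2))"
  have "r \<longlonglongrightarrow> 1" unfolding r_def by real_asymp
  then have "(\<lambda>n. ?G (r n)) \<longlonglongrightarrow> ?G 1"
    by (intro tendsto_intros)
  moreover have "?G (r n) \<le> ?E 1" for n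
    by (rule disc) (auto simp: r_def)
  ultimately have "?G 1 \<le> ?E 1"
    by (intro LIMSEQ_le_const2) auto
  then show ?thesis by simp
qed

section \<open>Grunsky coefficients for the indices 1 and 3\<close>

text \<open>Differentiating \<open>f z - f \<zeta> = (z - \<zeta>) exp (l z)\<close> and eliminating the exponential gives
a linear relation between the power series of \<open>f\<close> and of the derivative of \<open>l\<close>; comparing its
first three coefficients determines those of \<open>l\<close> one after the other.\<close>

lemma log_quotient_coefficients:
  fixes F L :: "complex fps"
  assumes f: "f has_fps_expansion F" and F: "fps_nth F 0 = 0" "fps_nth F 1 = 1" "fps_nth F 2 = 0"
    and l: "l holomorphic_on ball 0 1" "\<forall>z\<in>ball 0 1. f z - f \<zeta> = (z - \<zeta>) * exp (l z)"
      "l has_fps_expansion L"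
    and \<zeta>: "\<zeta> \<noteq> 0" and f\<zeta>: "f \<zeta> \<noteq> 0"
  shows "fps_nth L 1 = 1 / \<zeta> - 1 / f \<zeta>"
    and "fps_nth L 3 = (1 / \<zeta> ^ 3 - 1 / f \<zeta> ^ 3 - 3 * fps_nth F 3 / f \<zeta>) / 3"
proof -
  define W where "W = f \<zeta>"
  have eq: "deriv f z * (z - \<zeta>) = (f z - W) + (z - \<zeta>) * (f z - W) * deriv l z" if z: "z \<in> ball 0 1" for z
  proof -
    have dl: "(l has_field_derivative deriv l z) (at z)"
      by (rule holomorphic_derivI[OF l(1)]) (use z in auto)
    have "((\<lambda>u. W + (u - \<zeta>) * exp (l u)) has_field_derivative (exp (l z) + (z - \<zeta>) * exp (l z) * deriv l z)) (at z)"
      by (rule derivative_eq_intros dl refl)+ (simp add: algebra_simps)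
    then have "(f has_field_derivative (exp (l z) + (z - \<zeta>) * exp (l z) * deriv l z)) (at z)"
      by (rule DERIV_cong_ev[THEN iffD1, rotated 3])
         (use l(2) z in \<open>auto simp: W_def eventually_nhds algebra_simps intro!: exI[of _ "ball 0 1"]\<close>)
    then have "deriv f z = exp (l z) + (z - \<zeta>) * exp (l z) * deriv l z"
      by (rule DERIV_imp_deriv)
    moreover have "f z - W = (z - \<zeta>) * exp (l z)"
      using l(2) z by (simp add: W_def)
    ultimately show ?thesis by (simp only:) (simp add: algebra_simps)
  qed
  have lhs: "(\<lambda>z. deriv f z * (z - \<zeta>)) has_fps_expansion fps_deriv F * (fps_X - fps_const \<zeta>)"
    by (intro fps_expansion_intros f)
  have rhs: "(\<lambda>z. (f z - W) + (z - \<zeta>) * (f z - W) * deriv l z) has_fps_expansion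
      (F - fps_const W) + (fps_X - fps_const \<zeta>) * (F - fps_const W) * fps_deriv L"
    by (intro fps_expansion_intros f l(3))
  have "eventually (\<lambda>z. z \<in> ball 0 (1::real)) (nhds (0::complex))"
    by (intro eventually_nhds_in_open) auto
  then have "eventually (\<lambda>z. deriv f z * (z - \<zeta>) = (f z - W) + (z - \<zeta>) * (f z - W) * deriv l z) (nhds 0)"
    by eventually_elim (rule eq)
  then have "(\<lambda>z. deriv f z * (z - \<zeta>)) has_fps_expansion
      (F - fps_const W) + (fps_X - fps_const \<zeta>) * (F - fps_const W) * fps_deriv L"
    using rhs by (subst has_fps_expansion_cong) auto
  with lhs have fps: "fps_deriv F * (fps_X - fps_const \<zeta>) = (F - fps_const W) + (fps_X - fps_const \<zeta>) * (F - fps_const W) * fps_deriv L"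
    by (rule fps_expansion_unique_complex)
  note F' = F[unfolded One_nat_def numeral_2_eq_2]
  have W: "W \<noteq> 0" using f\<zeta> by (simp add: W_def)
  have c0: "- \<zeta> = - W + \<zeta> * W * fps_nth L 1"
    using arg_cong[OF fps, of "\<lambda>G. fps_nth G 0"] F by (simp add: fps_mult_nth)
  have c1: "1 = 1 + \<zeta> * W * (2 * fps_nth L 2) - (W + \<zeta>) * fps_nth L 1"
    using arg_cong[OF fps, of "\<lambda>G. fps_nth G 1"] F'
    by (simp add: fps_mult_nth eval_nat_numeral algebra_simps)
  have c2: "- 3 * fps_nth F 3 * \<zeta> = \<zeta> * W * (3 * fps_nth L 3) - (W + \<zeta>) * (2 * fps_nth L 2) + fps_nth L 1"
    using arg_cong[OF fps, of "\<lambda>G. fps_nth G 2"] F'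
    by (simp add: fps_mult_nth eval_nat_numeral algebra_simps)
  define u v where "u = 1 / \<zeta>" and "v = 1 / W"
  have uv: "u * \<zeta> = 1" "v * W = 1"
    using \<zeta> W by (auto simp: u_def v_def)
  have L1: "fps_nth L 1 = u - v"
    using c0 uv by algebra
  then show "fps_nth L 1 = 1 / \<zeta> - 1 / f \<zeta>"
    by (simp add: W_def u_def v_def)
  have "2 * fps_nth L 2 = (u * \<zeta>) * (v * W) * (2 * fps_nth L 2)"
    using uv by simp
  also have "\<dots> = u * v * (\<zeta> * W * (2 * fps_nth L 2))"
    by (simp add: mult_ac)
  also have "\<zeta> * W * (2 * fps_nth L 2) = (W + \<zeta>) * fps_nth L 1"
    using c1 by (simp add: algebra_simps)
  also have "u * v * \<dots> = (u * (v * W) + v * (u * \<zeta>)) * (u - v)"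
    unfolding L1 by (simp add: algebra_simps)
  finally have L2: "2 * fps_nth L 2 = u\<^sup>2 - v\<^sup>2"
    unfolding uv by (simp add: power2_eq_square algebra_simps)
  have "3 * fps_nth L 3 = (u * \<zeta>) * (v * W) * (3 * fps_nth L 3)"
    using uv by simp
  also have "\<dots> = u * v * (\<zeta> * W * (3 * fps_nth L 3))"
    by (simp add: mult_ac)
  also have "\<zeta> * W * (3 * fps_nth L 3) = - 3 * fps_nth F 3 * \<zeta> + (W + \<zeta>) * (2 * fps_nth L 2) - fps_nth L 1"
    using c2 by (simp add: algebra_simps)
  also have "u * v * \<dots> = - 3 * fps_nth F 3 * v * (u * \<zeta>) + (u * (v * W) + v * (u * \<zeta>)) * (2 * fps_nth L 2)
      - u * v * fps_nth L 1"
    by (simp add: algebra_simps)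
  finally have "3 * fps_nth L 3 = u ^ 3 - v ^ 3 - 3 * fps_nth F 3 * v"
    unfolding uv L1 L2 by (simp add: power2_eq_square power3_eq_cube algebra_simps)
  then have "fps_nth L 3 = (u ^ 3 - v ^ 3 - 3 * fps_nth F 3 * v) / 3"
    by (simp add: eq_divide_eq mult.commute[of _ 3])
  then show "fps_nth L 3 = (1 / \<zeta> ^ 3 - 1 / f \<zeta> ^ 3 - 3 * fps_nth F 3 / f \<zeta>) / 3"
    by (simp add: W_def u_def v_def power_divide)
qed

text \<open>Formal cancellation of a power of the variable agrees with analytic division; this removes the
singularities at 0 of the functions \<open>k n\<close> and supplies their expansions.\<close>

lemma holomorphic_divide_power:
  fixes G :: "complex fps"
  assumes H: "H holomorphic_on ball 0 1" "H has_fps_expansion G" and n: "\<And>i. i < n \<Longrightarrow> fps_nth G i = 0"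
  obtains K where "K holomorphic_on ball 0 1" "\<And>z. z \<noteq> 0 \<Longrightarrow> K z = H z / z ^ n"
    "K has_fps_expansion fps_shift n G"
proof (cases "G = 0")
  case True
  have "H z = 0" if "z \<in> ball 0 1" for z
    using has_fps_expansion_imp_eval_fps_eq[OF H(2) _ H(1), of z] that True by simp
  then have zero: "H z / z ^ n = 0" if "z \<in> ball 0 1" for z
    using that by simp
  show ?thesis
  proof (rule that[of "\<lambda>z. H z / z ^ n"])
    show "(\<lambda>z. H z / z ^ n) holomorphic_on ball 0 1"
      by (rule holomorphic_transform[of "\<lambda>_. 0"]) (use zero in auto)
    have "eventually (\<lambda>z. z \<in> ball 0 (1::real)) (nhds (0::complex))"
      by (intro eventually_nhds_in_open) auto
    then have "eventually (\<lambda>z. H z / z ^ n = 0) (nhds 0)"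
      by eventually_elim (rule zero)
    then show "(\<lambda>z. H z / z ^ n) has_fps_expansion fps_shift n G"
      using True by (simp add: has_fps_expansion_0_iff)
  qed simp
next
  case False
  define K where "K = (\<lambda>z. if z = 0 then fps_nth G n else H z / z ^ n)"
  have K: "K has_fps_expansion fps_shift n G"
    unfolding K_def by (intro has_fps_expansion_shift[OF H(2)] subdegree_geI False n refl)
  have "K holomorphic_on ball 0 1"
    unfolding holomorphic_on_def
  proof
    fix z :: complex assume z: "z \<in> ball 0 1"
    show "K field_differentiable at z within ball 0 1"
    proof (cases "z = 0")
      case True
      have "K analytic_on {0}"
        using K by (rule has_fps_expansion_imp_analytic_0)
      then have "K field_differentiable at 0"
        by (rule analytic_on_imp_differentiable_at) simp
      then show ?thesis
        using True by (simp add: field_differentiable_at_within)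
    next
      case False
      have "(\<lambda>z. H z / z ^ n) holomorphic_on ball 0 1 - {0}"
        by (intro holomorphic_intros holomorphic_on_subset[OF H(1)]) auto
      then have "K holomorphic_on ball 0 1 - {0}"
        by (rule holomorphic_transform) (auto simp: K_def)
      then have "K field_differentiable at z"
        by (rule holomorphic_on_imp_differentiable_at) (use False z in auto)
      then show ?thesis
        by (rule field_differentiable_at_within)
    qed
  qed
  with K show ?thesis by (intro that[of K]) (auto simp: K_def)
qed

text \<open>The Grunsky inequality for the index set \<open>{1, 3}\<close>, in terms of Taylor coefficients. Only the entry
\<open>g\<close> of index \<open>(3, 3)\<close> is left implicit: it is eliminated by symmetry in one application, and in
the other one the vanishing coefficients reduce it to a single term.\<close>

lemma grunsky_inequality_1_3:
  fixes F :: "complex fps"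
  assumes holo: "f holomorphic_on ball 0 1" and inj: "inj_on f (ball 0 1)"
    and f: "f has_fps_expansion F"
    and F: "fps_nth F 0 = 0" "fps_nth F 1 = 1" "fps_nth F 2 = 0"
  obtains g where
    "\<And>x y. Re (x\<^sup>2 * fps_nth F 3 + 2 * x * y * (fps_nth F 5 - (fps_nth F 3)\<^sup>2) + y\<^sup>2 * g)
        \<le> (cmod x)\<^sup>2 + (cmod y)\<^sup>2 / 3"
    "fps_nth F 3 = 0 \<Longrightarrow> fps_nth F 4 = 0 \<Longrightarrow> g = fps_nth F 7"
proof -
  define a where "a = fps_nth F 3"
  have f0: "f 0 = 0"
    using has_fps_expansion_imp_0_eq_fps_nth_0[OF f] F by simp
  obtain h where h: "h holomorphic_on ball 0 1" "\<And>z. z \<noteq> 0 \<Longrightarrow> h z = f z / z ^ 1"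
      "h has_fps_expansion fps_shift 1 F"
    using holomorphic_divide_power[OF holo f, of 1] F by auto
  have fnz: "f z \<noteq> 0" if "z \<in> ball 0 1 - {0}" for z
    using inj_onD[OF inj, of z 0] that f0 by auto
  have hnz: "h z \<noteq> 0" if "z \<in> ball 0 1" for z
    using h(2)[of z] fnz[of z] has_fps_expansion_imp_0_eq_fps_nth_0[OF h(3)] F that by (cases "z = 0") auto
  \<comment> \<open>The series of \<open>z / f z\<close>; the functions \<open>k n\<close> are built from its powers.\<close>
  define P where "P = inverse (fps_shift 1 F)"
  have P: "(\<lambda>z. inverse (h z)) has_fps_expansion P"
    unfolding P_def by (rule has_fps_expansion_inverse[OF h(3)]) (use F in simp)
  have PF: "P * fps_shift 1 F = 1"
    unfolding P_def by (rule inverse_mult_eq_1) (use F in simp)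
  note F' = F[unfolded One_nat_def numeral_2_eq_2]
  note nth = fps_mult_nth eval_nat_numeral power3_eq_cube power2_eq_square
  have p0: "fps_nth P 0 = 1"
    using arg_cong[OF PF, of "\<lambda>G. fps_nth G 0"] F' by (simp add: nth)
  have p1: "fps_nth P 1 = 0"
    using arg_cong[OF PF, of "\<lambda>G. fps_nth G 1"] F' p0 by (simp add: nth)
  have p2: "fps_nth P 2 = - a"
    using arg_cong[OF PF, of "\<lambda>G. fps_nth G 2"] F' p0 p1
    by (simp add: nth a_def eq_neg_iff_add_eq_0 add.commute)
  have p3: "fps_nth P 3 = - fps_nth F 4"
    using arg_cong[OF PF, of "\<lambda>G. fps_nth G 3"] F' p0 p1
    by (simp add: nth eq_neg_iff_add_eq_0 add.commute)
  have "fps_nth P 4 + fps_nth P 2 * a + fps_nth F 5 = 0"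
    using arg_cong[OF PF, of "\<lambda>G. fps_nth G 4"] F' p0 p1
    by (simp add: nth a_def algebra_simps)
  then have p4: "fps_nth P 4 = a\<^sup>2 - fps_nth F 5"
    using p2 by algebra
  have p6: "fps_nth P 6 = - fps_nth F 7" if "a = 0" "fps_nth F 4 = 0"
    using arg_cong[OF PF, of "\<lambda>G. fps_nth G 6"] F' p0 p1 p2 that
    by (simp add: nth a_def eq_neg_iff_add_eq_0 add.commute)
  note p = p0 p1[unfolded One_nat_def] p2[unfolded eval_nat_numeral, simplified] p3[unfolded eval_nat_numeral, simplified]
    p4[unfolded eval_nat_numeral, simplified]
  have cube: "fps_nth (P ^ 3) 0 = 1" "fps_nth (P ^ 3) 1 = 0" "fps_nth (P ^ 3) 2 = - 3 * a"
    using p by (simp_all add: nth)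
  have "fps_nth (P ^ 3) 4 = 3 * fps_nth P 4 + 3 * (fps_nth P 2)\<^sup>2"
    using p0 p1 by (simp add: nth algebra_simps)
  then have cube4: "fps_nth (P ^ 3) 4 = 3 * (a\<^sup>2 - fps_nth F 5) + 3 * a\<^sup>2"
    by (simp add: p2 p4)
  have cube6: "fps_nth (P ^ 3) 6 = - 3 * fps_nth F 7" if "a = 0" "fps_nth F 4 = 0"
    using p p6[OF that, unfolded eval_nat_numeral, simplified] that by (simp add: nth)

  let ?H1 = "\<lambda>z. 1 - inverse (h z)" and ?G1 = "1 - P"
  let ?H3 = "\<lambda>z. 1 / 3 * (1 - inverse (h z) ^ 3 - 3 * a * z ^ 2 * inverse (h z))"
  let ?G3 = "fps_const (1 / 3) * (1 - P ^ 3 - fps_const (3 * a) * fps_X ^ 2 * P)"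
  have G3: "fps_nth ?G3 0 = 0" "fps_nth ?G3 1 = 0" "fps_nth ?G3 2 = 0"
    using cube p0 by (simp_all add: fps_X_power_mult_nth mult.assoc)
  have G34: "fps_nth ?G3 4 = fps_nth F 5 - a\<^sup>2"
    using p2 by (simp add: fps_X_power_mult_nth mult.assoc cube4 power2_eq_square field_simps)
  have G36: "fps_nth ?G3 6 = fps_nth F 7" if "a = 0" "fps_nth F 4 = 0"
    using cube6[OF that] that by simp
  have H1: "?H1 holomorphic_on ball 0 1" "?H1 has_fps_expansion ?G1"
    by (intro holomorphic_intros h(1) hnz; simp) (intro fps_expansion_intros P)
  have H3: "?H3 holomorphic_on ball 0 1" "?H3 has_fps_expansion ?G3"
    by (intro holomorphic_intros h(1) hnz; simp) (intro fps_expansion_intros P)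
  obtain k1 where k1: "k1 holomorphic_on ball 0 1" "\<And>z. z \<noteq> 0 \<Longrightarrow> k1 z = ?H1 z / z ^ 1"
      "k1 has_fps_expansion fps_shift 1 ?G1"
    using holomorphic_divide_power[OF H1, of 1] p0 by auto
  have "i < 3 \<Longrightarrow> fps_nth ?G3 i = 0" for i
    using G3 by (auto simp: less_Suc_eq eval_nat_numeral)
  then obtain k3 where k3: "k3 holomorphic_on ball 0 1" "\<And>z. z \<noteq> 0 \<Longrightarrow> k3 z = ?H3 z / z ^ 3"
      "k3 has_fps_expansion fps_shift 3 ?G3"
    using holomorphic_divide_power[OF H3, of 3] by blast
  define k where "k = (\<lambda>n::nat. if n = 1 then k1 else k3)"
  define x' where "x' = (\<lambda>x y. \<lambda>n::nat. if n = 1 then x else y :: complex)"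
  define g where "g = fps_nth (fps_shift 3 ?G3) 3"
  have k_coeff: "fps_nth L n = k n \<zeta>"
    if n: "n \<in> {1, 3}" and \<zeta>: "\<zeta> \<in> ball 0 1 - {0}" and l: "l holomorphic_on ball 0 1"
      "\<forall>z\<in>ball 0 1. f z - f \<zeta> = (z - \<zeta>) * exp (l z)" "l has_fps_expansion L" for n \<zeta> l L
  proof -
    have nz: "\<zeta> \<noteq> 0" "f \<zeta> \<noteq> 0" using \<zeta> fnz by auto
    have inv: "inverse (h \<zeta>) = \<zeta> / f \<zeta>" using h(2)[of \<zeta>] nz by simp
    have "k1 \<zeta> = 1 / \<zeta> - 1 / f \<zeta>"
      unfolding k1(2)[OF nz(1)] inv using nz by (simp add: diff_divide_distrib)
    moreover have "k3 \<zeta> = (1 / \<zeta> ^ 3 - 1 / f \<zeta> ^ 3 - 3 * a / f \<zeta>) / 3"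
      unfolding k3(2)[OF nz(1)] inv using nz by (simp add: field_simps power2_eq_square power3_eq_cube)
    ultimately have "fps_nth L 1 = k1 \<zeta>" "fps_nth L 3 = k3 \<zeta>"
      by (simp_all only: log_quotient_coefficients[OF f F l nz] a_def)
    then show ?thesis
      using n by (auto simp: k_def)
  qed
  have grunsky: "Re (\<Sum>m\<in>{1,3}. \<Sum>n\<in>{1,3}. x' x y m * x' x y n * fps_nth (fps_expansion (k n) 0) m)
      \<le> (\<Sum>n\<in>{1,3}. (cmod (x' x y n))\<^sup>2 / n)" for x y
    by (rule grunsky_inequality[OF _ _ holo inj]) (use k1(1) k3(1) k_coeff in \<open>auto simp: k_def\<close>)
  have form: "(\<Sum>m\<in>{1,3}. \<Sum>n\<in>{1,3}. x' x y m * x' x y n * fps_nth (fps_expansion (k n) 0) m)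
      = x\<^sup>2 * a + 2 * x * y * (fps_nth F 5 - a\<^sup>2) + y\<^sup>2 * g" for x y
  proof -
    have expansions: "fps_expansion k1 0 = fps_shift 1 ?G1" "fps_expansion k3 0 = fps_shift 3 ?G3"
      by (intro fps_expansion_eqI k1 k3)+
    have index: "1 + 3 = (4 :: nat)"
      by simp
    have coeffs1: "fps_nth (fps_expansion k1 0) 1 = a" "fps_nth (fps_expansion k1 0) 3 = fps_nth F 5 - a\<^sup>2"
      unfolding expansions fps_shift_nth using p2[unfolded numeral_2_eq_2] p4 by simp_all
    have coeffs3: "fps_nth (fps_expansion k3 0) 1 = fps_nth F 5 - a\<^sup>2" "fps_nth (fps_expansion k3 0) 3 = g"
      unfolding expansions g_def by (simp_all only: fps_shift_nth index G34)
    have "(\<Sum>m\<in>{1,3}. \<Sum>n\<in>{1,3}. x' x y m * x' x y n * fps_nth (fps_expansion (k n) 0) m)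
        = x * x * fps_nth (fps_expansion k1 0) 1 + x * y * fps_nth (fps_expansion k3 0) 1
          + (y * x * fps_nth (fps_expansion k1 0) 3 + y * y * fps_nth (fps_expansion k3 0) 3)"
      by (simp add: k_def x'_def)
    then show ?thesis
      unfolding coeffs1 coeffs3 by (simp add: power2_eq_square algebra_simps)
  qed
  have norms: "(\<Sum>n\<in>{1,3}. (cmod (x' x y n))\<^sup>2 / n) = (cmod x)\<^sup>2 + (cmod y)\<^sup>2 / 3" for x y
    by (simp add: x'_def)
  have "6 = 3 + (3 :: nat)"
    by simp
  then have "g = fps_nth F 7" if "fps_nth F 3 = 0" "fps_nth F 4 = 0"
    using G36 that by (simp only: a_def g_def fps_shift_nth)
  then show ?thesis
    using that[of g] grunsky unfolding form norms a_def by blast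
qed

lemma exists_phase: "\<exists>u. cmod u = 1 \<and> u\<^sup>2 * z = of_real (cmod z)"
proof (cases "z = 0")
  case False
  have "(csqrt (of_real (cmod z) / z))\<^sup>2 * z = of_real (cmod z)"
    using False by simp
  moreover have "cmod (csqrt (of_real (cmod z) / z)) = 1"
    using False by (simp add: norm_divide)
  ultimately show ?thesis by blast
qed (auto intro: exI[of _ 1])

text \<open>The first and the third bound are the diagonal entries of the Grunsky form, with the phase of the
variable chosen to make them positive. For the off-diagonal entry, multiplying \<open>(x, y)\<close> by
\<open>(\<i>, -\<i>)\<close> changes the sign of the diagonal terms only, so the sum of the two
inequalities isolates it; the weight \<open>sqrt 3\<close> on \<open>y\<close> balances the two squares on the right.\<close>

lemma univalent_coefficient_bounds:
  fixes F :: "complex fps"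
  assumes holo: "f holomorphic_on ball 0 1" and inj: "inj_on f (ball 0 1)"
    and f: "f has_fps_expansion F"
    and F: "fps_nth F 0 = 0" "fps_nth F 1 = 1" "fps_nth F 2 = 0"
  shows "cmod (fps_nth F 3) \<le> 1"
    and "cmod (fps_nth F 5 - (fps_nth F 3)\<^sup>2) \<le> 1 / sqrt 3"
    and "fps_nth F 3 = 0 \<Longrightarrow> fps_nth F 4 = 0 \<Longrightarrow> cmod (fps_nth F 7) \<le> 1 / 3"
proof -
  let ?b = "fps_nth F 5 - (fps_nth F 3)\<^sup>2"
  obtain g where g: "\<And>x y. Re (x\<^sup>2 * fps_nth F 3 + 2 * x * y * ?b + y\<^sup>2 * g) \<le> (cmod x)\<^sup>2 + (cmod y)\<^sup>2 / 3"
    and g7: "fps_nth F 3 = 0 \<Longrightarrow> fps_nth F 4 = 0 \<Longrightarrow> g = fps_nth F 7"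
    using grunsky_inequality_1_3[OF holo inj f F] by metis
  obtain u where u: "cmod u = 1" "u\<^sup>2 * fps_nth F 3 = of_real (cmod (fps_nth F 3))"
    using exists_phase by blast
  show "cmod (fps_nth F 3) \<le> 1"
    using g[of u 0] u by simp
  obtain v where v: "cmod v = 1" "v\<^sup>2 * g = of_real (cmod g)"
    using exists_phase by blast
  show "cmod (fps_nth F 7) \<le> 1 / 3" if "fps_nth F 3 = 0" "fps_nth F 4 = 0"
  proof -
    have "Re (v\<^sup>2 * g) \<le> 1 / 3"
      using g[of 0 v] v(1) by simp
    then have "cmod g \<le> 1 / 3"
      unfolding v(2) by simp
    then show ?thesis
      by (simp add: g7[OF that])
  qed
  obtain w where w: "cmod w = 1" "w\<^sup>2 * ?b = of_real (cmod ?b)"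
    using exists_phase by blast
  let ?s = "complex_of_real (sqrt 3)"
  let ?X = "w\<^sup>2 * fps_nth F 3" and ?Y = "(w * ?s)\<^sup>2 * g"
  have cross: "2 * w * (w * ?s) * ?b = of_real (2 * sqrt 3 * cmod ?b)"
    using w(2) by (simp add: power2_eq_square mult_ac)
  have "Re (?X + of_real (2 * sqrt 3 * cmod ?b) + ?Y) \<le> 1 + 3 / 3"
    using g[of w "w * ?s"] w(1) unfolding cross by (simp add: norm_mult)
  moreover have "Re (- ?X + of_real (2 * sqrt 3 * cmod ?b) + - ?Y) \<le> 1 + 3 / 3"
  proof -
    have flip: "(\<i> * w)\<^sup>2 * fps_nth F 3 = - ?X" "(- \<i> * (w * ?s))\<^sup>2 * g = - ?Y"
      by (simp_all add: power_mult_distrib)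
    have keep: "2 * (\<i> * w) * (- \<i> * (w * ?s)) * ?b = of_real (2 * sqrt 3 * cmod ?b)"
      unfolding cross[symmetric] by (simp add: algebra_simps)
    show ?thesis
      using g[of "\<i> * w" "- \<i> * (w * ?s)"] w(1) unfolding flip keep by (simp add: norm_mult)
  qed
  ultimately have "sqrt 3 * cmod ?b \<le> 1" by simp
  then show "cmod ?b \<le> 1 / sqrt 3"
    by (simp add: field_simps)
qed

text \<open>The function \<open>q z = sqrt (f (z\<^sup>2))\<close>, realised as \<open>z * g (z\<^sup>2)\<close> with
\<open>(g z)\<^sup>2 = f z / z\<close>. It is univalent: equal values force \<open>y\<^sup>2 = z\<^sup>2\<close>, and then the
common nonzero factor \<open>g (z\<^sup>2)\<close> fixes the sign. Its expansion is sparse, and its coefficient of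
index 7 carries the fourth coefficient of \<open>f\<close>.\<close>

lemma odd_square_root_transform:
  fixes F :: "complex fps"
  assumes holo: "f holomorphic_on ball 0 1" and inj: "inj_on f (ball 0 1)"
    and f: "f has_fps_expansion F"
    and F: "fps_nth F 0 = 0" "fps_nth F 1 = 1" "fps_nth F 2 = 0"
  obtains q Q where "q holomorphic_on ball 0 1" "inj_on q (ball 0 1)" "q has_fps_expansion Q"
    "fps_nth Q 0 = 0" "fps_nth Q 1 = 1" "fps_nth Q 2 = 0" "fps_nth Q 3 = 0" "fps_nth Q 4 = 0"
    "fps_nth Q 7 = fps_nth F 4 / 2"
proof -
  have f0: "f 0 = 0"
    using has_fps_expansion_imp_0_eq_fps_nth_0[OF f] F by simp
  obtain h where h: "h holomorphic_on ball 0 1" "\<And>z. z \<noteq> 0 \<Longrightarrow> h z = f z / z ^ 1"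
      "h has_fps_expansion fps_shift 1 F"
    using holomorphic_divide_power[OF holo f, of 1] F by auto
  have h0: "h 0 = 1"
    using has_fps_expansion_imp_0_eq_fps_nth_0[OF h(3)] F by simp
  have hf: "f z = z * h z" for z
    using h(2)[of z] f0 by (cases "z = 0") auto
  have hnz: "h z \<noteq> 0" if "z \<in> ball 0 1" for z
    using inj_onD[OF inj, of z 0] that f0 hf[of z] h0 by (cases "z = 0") auto
  obtain p where p: "p holomorphic_on ball 0 1" "\<And>z. z \<in> ball 0 1 \<Longrightarrow> h z = exp (p z)"
    using contractible_imp_holomorphic_log[OF h(1) _ hnz] convex_imp_contractible[OF convex_ball] by metis
  define g where "g = (\<lambda>z. exp ((p z - p 0) / 2))"
  have g: "g holomorphic_on ball 0 1"
    unfolding g_def by (intro holomorphic_intros p) auto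
  have g2: "(g z)\<^sup>2 = h z" if "z \<in> ball 0 1" for z
  proof -
    have "(g z)\<^sup>2 = exp (p z - p 0)"
      unfolding g_def exp_double[symmetric] by (simp del: right_diff_distrib_numeral)
    also have "\<dots> = h z"
      using p(2)[of z] p(2)[of 0] that h0 by (simp add: exp_diff)
    finally show ?thesis .
  qed
  define G where "G = fps_expansion g 0"
  have G: "g has_fps_expansion G"
    unfolding G_def by (rule has_fps_expansion_fps_expansion[OF _ _ g]) auto
  have "eventually (\<lambda>z. z \<in> ball 0 (1::real)) (nhds (0::complex))"
    by (intro eventually_nhds_in_open) auto
  then have "eventually (\<lambda>z. (g z)\<^sup>2 = h z) (nhds 0)"
    by eventually_elim (rule g2)
  moreover have "(\<lambda>z. (g z)\<^sup>2) has_fps_expansion G\<^sup>2"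
    by (intro fps_expansion_intros G)
  ultimately have "h has_fps_expansion G\<^sup>2"
    by (subst (asm) has_fps_expansion_cong) auto
  then have GF: "G\<^sup>2 = fps_shift 1 F"
    using h(3) by (rule fps_expansion_unique_complex)
  note F' = F[unfolded One_nat_def numeral_2_eq_2]
  have G0: "fps_nth G 0 = 1"
    using has_fps_expansion_imp_0_eq_fps_nth_0[OF G] by (simp add: g_def)
  have G1: "fps_nth G 1 = 0"
    using arg_cong[OF GF, of "\<lambda>G. fps_nth G 1"] F' G0
    by (simp add: power2_eq_square fps_mult_nth eval_nat_numeral)
  have G3: "fps_nth G 3 = fps_nth F 4 / 2"
    using arg_cong[OF GF, of "\<lambda>G. fps_nth G 3"] F' G0 G1
    by (simp add: power2_eq_square fps_mult_nth eval_nat_numeral mult.commute)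
  define q where "q = (\<lambda>z. z * g (z ^ 2))"
  define Q where "Q = fps_X * (G oo fps_X ^ 2)"
  have sq: "z\<^sup>2 \<in> ball 0 1" if "z \<in> ball 0 1" for z :: complex
    using that by (simp add: norm_power power_less_one_iff)
  have "(g \<circ> (\<lambda>z. z ^ 2)) holomorphic_on ball 0 1"
    by (rule holomorphic_on_compose_gen[OF _ g]) (auto intro!: holomorphic_intros sq)
  then have q_holo: "q holomorphic_on ball 0 1"
    unfolding q_def by (intro holomorphic_intros) (simp add: o_def)
  have "(g \<circ> (\<lambda>z. z ^ 2)) has_fps_expansion (G oo fps_X ^ 2)"
    by (intro has_fps_expansion_compose G fps_expansion_intros) simp
  then have q_exp: "q has_fps_expansion Q"
    unfolding q_def Q_def by (intro fps_expansion_intros) (simp add: o_def)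
  have "inj_on q (ball 0 1)"
  proof (rule inj_onI)
    fix y z assume y: "y \<in> ball 0 1" and z: "z \<in> ball 0 1" and eq: "q y = q z"
    have q2: "(q x)\<^sup>2 = f (x\<^sup>2)" if "x \<in> ball 0 1" for x
      using g2[OF sq[OF that]] by (simp add: q_def hf[of "x\<^sup>2"] power_mult_distrib)
    have "f (y\<^sup>2) = f (z\<^sup>2)"
      using eq q2[OF y] q2[OF z] by simp
    then have yz: "y\<^sup>2 = z\<^sup>2"
      using inj_onD[OF inj] sq y z by blast
    have "g (z\<^sup>2) \<noteq> 0"
      by (simp add: g_def)
    then show "y = z"
      using eq yz by (simp add: q_def)
  qed
  then show ?thesis
    using q_holo q_exp G0 G1 G3
    by (intro that[of q Q]) (simp_all add: Q_def fps_nth_compose_X_power)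
qed

section \<open>Functions with vanishing second coefficient\<close>

theorem theorem1:
  fixes f :: "complex \<Rightarrow> complex" and a :: "nat \<Rightarrow> complex"
  assumes "f \<in> class_S"
    and "\<And>z. norm z < 1 \<Longrightarrow> (\<lambda>n. a (n + 2) * z ^ (n + 2)) sums (f z - z)"
    and "a 2 = 0"
  shows "norm (a 3) \<le> 1 \<and>
         norm (a 4) \<le> 2 / 3 \<and>
         norm (a 5) \<le> 503 / 300 \<and>
         norm (H2_2 a) \<le> 1 \<and>
         norm (H3_1 a) \<le> 21 / 20"
proof -
  have holo: "f holomorphic_on ball 0 1" and inj: "inj_on f (ball 0 1)"
    using assms(1) by (auto simp: class_S_def analytic_imp_holomorphic)
  define F where "F = Abs_fps (\<lambda>n. if n = 0 then 0 else if n = 1 then 1 else a n)"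
  have "(\<lambda>n. fps_nth F n * z ^ n) sums f z" if "z \<in> ball 0 1" for z
  proof -
    have "(\<lambda>n. fps_nth F (n + 2) * z ^ (n + 2)) sums (f z - z)"
      using assms(2)[of z] that by (simp add: F_def)
    then have "(\<lambda>n. fps_nth F n * z ^ n) sums (f z - z + (\<Sum>n<2. fps_nth F n * z ^ n))"
      by (subst (asm) sums_iff_shift)
    then show ?thesis by (simp add: F_def eval_nat_numeral)
  qed
  moreover have "eventually (\<lambda>z. z \<in> ball 0 (1::real)) (nhds (0::complex))"
    by (intro eventually_nhds_in_open) auto
  ultimately have f: "f has_fps_expansion F"
    by (intro has_fps_expansionI) (auto elim: eventually_mono)
  have F: "fps_nth F 0 = 0" "fps_nth F 1 = 1" "fps_nth F 2 = 0"
    using assms(3) by (simp_all add: F_def)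
  have F_nth: "fps_nth F 3 = a 3" "fps_nth F 4 = a 4" "fps_nth F 5 = a 5"
    by (simp_all add: F_def)
  have a3: "cmod (a 3) \<le> 1"
    using univalent_coefficient_bounds(1)[OF holo inj f F] by (simp add: F_nth)
  have "1 / sqrt 3 \<le> (3 / 5 :: real)"
    using real_le_rsqrt[of "5 / 3" 3] by (simp add: field_simps power2_eq_square)
  then have b: "cmod (a 5 - (a 3)\<^sup>2) \<le> 3 / 5"
    using univalent_coefficient_bounds(2)[OF holo inj f F] by (simp add: F_nth)
  obtain q Q where q: "q holomorphic_on ball 0 1" "inj_on q (ball 0 1)" "q has_fps_expansion Q"
      "fps_nth Q 0 = 0" "fps_nth Q 1 = 1" "fps_nth Q 2 = 0" "fps_nth Q 3 = 0" "fps_nth Q 4 = 0"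
      "fps_nth Q 7 = fps_nth F 4 / 2"
    using odd_square_root_transform[OF holo inj f F] by blast
  have a4: "cmod (a 4) \<le> 2 / 3"
    using univalent_coefficient_bounds(3)[OF q(1-8)] by (simp add: q(9) F_nth norm_divide)
  have a3_sq: "cmod ((a 3)\<^sup>2) \<le> 1"
    using a3 by (simp add: norm_power power_le_one)
  have a5: "cmod (a 5) \<le> 503 / 300"
    using norm_triangle_ineq[of "a 5 - (a 3)\<^sup>2" "(a 3)\<^sup>2"] b a3_sq by simp
  \<comment> \<open>Grouped so that the bounded off-diagonal Grunsky coefficient \<open>a 5 - (a 3)\<^sup>2\<close> appears.\<close>
  have "H3_1 a = a 3 * (a 5 - (a 3)\<^sup>2) - (a 4)\<^sup>2"
    using assms(3) by (simp add: H3_1_def algebra_simps power2_eq_square)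
  then have "cmod (H3_1 a) \<le> cmod (a 3) * cmod (a 5 - (a 3)\<^sup>2) + (cmod (a 4))\<^sup>2"
    using norm_triangle_ineq4[of "a 3 * (a 5 - (a 3)\<^sup>2)" "(a 4)\<^sup>2"] by (simp add: norm_mult norm_power)
  also have "\<dots> \<le> 1 * (3 / 5) + (2 / 3)\<^sup>2"
    using a3 b a4 by (intro add_mono mult_mono power_mono) auto
  finally have "cmod (H3_1 a) \<le> 21 / 20"
    by (simp add: power2_eq_square)
  moreover have "cmod (H2_2 a) \<le> 1"
    using assms(3) a3_sq by (simp add: H2_2_def)
  ultimately show ?thesis
    using a3 a4 a5 by simp
qed

end
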